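(* Let $\{P_n\}_{n\in\mathbb{N}}$ be such that $P_n \in \mathcal{E}_n$ is lazy and reversible for each $n \in \mathbb{N}$. (i) If $\{P_n\}_{n\in\mathbb{N}}$ exhibits pre-cutoff, then the restart sensitivity condition (defined in the context) holds. (ii) If $$\sup_{\epsilon \in (0,1/2)} \liminf_{n\to\infty} \frac{t_{\text{mix}}^{(n)}(\epsilon)}{t_{\text{mix}}^{(n)}(1-\epsilon)} = \infty ,$$ then the restart sensitivity condition fails.
   Context: All vectors are row vectors. $[n] = \{1,\ldots,n\}$; $\Delta_{n-1}$ is the set of probability distributions on $[n]$; $e_i$ is the $i$-th standard basis vector; $1_n$ is the length-$n$ row vector of ones; $\mathsf{T}$ denotes transpose. $\|\mu-\nu\| = \max_{A \subset [n]} |\mu(A)-\nu(A)|$ is total variation distance for $\mu,\nu \in \Delta_{n-1}$. $\mathcal{E}_n$ is the set of $n \times n$ transition matrices of time-homogeneous, irreducible, aperiodic Markov chains on state space $[n]$. For $P_n \in \mathcal{E}_n$, $\pi_n$ denotes its unique stationary distribution. $P_n$ is lazy if $P_n(i,i) \geq 1/2$ for all $i \in [n]$, and reversible if $\pi_n(i)P_n(i,j) = \pi_n(j)P_n(j,i)$ for all $i,j \in [n]$. $d_n(t) = \max_{i \in [n]} \|e_i P_n^t - \pi_n\|$ for $t \in \{0,1,2,\ldots\}$, and for $\epsilon \in (0,1)$ the $\epsilon$-mixing time is $t_{\text{mix}}^{(n)}(\epsilon) = \min\{t \in \{0,1,2,\ldots\} : d_n(t) \leq \epsilon\}$. The sequence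 $\{P_n\}_{n\in\mathbb{N}}$ exhibits pre-cutoff if $\sup_{\epsilon\in(0,1/2)} \limsup_{n\to\infty} t_{\text{mix}}^{(n)}(\epsilon)/t_{\text{mix}}^{(n)}(1-\epsilon) < \infty$. For $\alpha \in (0,1)$ and $\sigma_n \in \Delta_{n-1}$, the restart perturbation is $P_{\alpha,\sigma_n} = (1-\alpha)P_n + \alpha 1_n^{\mathsf{T}}\sigma_n$ (which is again in $\mathcal{E}_n$), and $\pi_{\alpha,\sigma_n}$ denotes its unique stationary distribution. A family $\{\alpha_{n,\epsilon}\}_{n\in\mathbb{N},\epsilon\in(0,1/2)} \subset (0,1)$ coincides with the mixing times $\{t_{\text{mix}}^{(n)}(\epsilon)\}_{n\in\mathbb{N},\epsilon\in(0,1)}$ if both of the following hold: (a) $\sup_{\epsilon\in(0,1/2)} \liminf_{n\to\infty} \alpha_{n,\epsilon} t_{\text{mix}}^{(n)}(\epsilon) = \infty$; (b) $\frac{\alpha_{n,\epsilon}}{\alpha_{n,\delta}} \in \left[\frac{t_{\text{mix}}^{(n)}(1-\delta)}{t_{\text{mix}}^{(n)}(1-\epsilon)}, 1\right]$ for all $\epsilon,\delta \in (0,1/2)$ with $\epsilon \geq \delta$ and all $n \in \mathbb{N}$. Restart sensitivity condition: for every family $\{\alpha_{n,\epsilon}\}_{n\in\mathbb{N},\epsilon\in(0,1/2)} \subset (0,1)$ that coincides with the mixing times $\{t_{\text{mix}}^{(n)}(\epsilon)\}_{n\in\mathbb{N},\epsilon\in(0,1)}$, there exists $\{\sigma_{n,\epsilon}\}_{n\in\mathbb{N},\epsilon\in(0,1/2)}$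 with $\sigma_{n,\epsilon} \in \Delta_{n-1}$ for all $n \in \mathbb{N}$, $\epsilon\in(0,1/2)$, such that $\lim_{n\to\infty} \|\pi_n - \pi_{\alpha_{n,\epsilon},\sigma_{n,\epsilon}}\| = 1$ for all $\epsilon\in(0,1/2)$. *)

theory Defs
  imports "HOL-Library.Extended_Real" "HOL-Library.Liminf_Limsup" "Jordan_Normal_Form.Matrix"
begin

text \<open>
  The state space with \<open>n\<close> elements is \<open>{0..<n}\<close> rather than \<open>{1,\<dots>,n}\<close>, matching the indexing of
  vectors and matrices. Vectors are row vectors.
\<close>

definition vec_mult_mat :: "'a :: semiring_0 vec \<Rightarrow> 'a mat \<Rightarrow> 'a vec" (infixl \<open>\<^sub>v*\<close> 70) where
  "v \<^sub>v* A = vec (dim_col A) (\<lambda>j. v \<bullet> col A j)"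

definition prob_vecs :: "nat \<Rightarrow> real vec set" where
  "prob_vecs n = {p \<in> carrier_vec n. (\<forall>i<n. 0 \<le> p $ i) \<and> (\<Sum>i<n. p $ i) = 1}"

definition stochastic_mats :: "nat \<Rightarrow> real mat set" where
  "stochastic_mats n = {P \<in> carrier_mat n n. \<forall>i<n. row P i \<in> prob_vecs n}"

definition irreducible_chain :: "real mat \<Rightarrow> bool" where
  "irreducible_chain P \<longleftrightarrow> (\<forall>i<dim_row P. \<forall>j<dim_row P. \<exists>t. (P ^\<^sub>m t) $$ (i, j) > 0)"

definition aperiodic_chain :: "real mat \<Rightarrow> bool" where
  "aperiodic_chain P \<longleftrightarrow> (\<forall>i<dim_row P. Gcd {t. t \<ge> 1 \<and> (P ^\<^sub>m t) $$ (i, i) > 0} = 1)"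

definition ergodic_mats :: "nat \<Rightarrow> real mat set" where
  "ergodic_mats n = {P \<in> stochastic_mats n. irreducible_chain P \<and> aperiodic_chain P}"

text \<open>The description is meaningful for ergodic chains, whose stationary distribution is unique.\<close>

definition stationary_dist :: "real mat \<Rightarrow> real vec" where
  "stationary_dist P = (THE p. p \<in> prob_vecs (dim_row P) \<and> p \<^sub>v* P = p)"

definition lazy_chain :: "real mat \<Rightarrow> bool" where
  "lazy_chain P \<longleftrightarrow> (\<forall>i<dim_row P. P $$ (i, i) \<ge> 1 / 2)"

definition reversible_chain :: "real mat \<Rightarrow> bool" where
  "reversible_chain P \<longleftrightarrow> (\<forall>i<dim_row P. \<forall>j<dim_row P.
     stationary_dist P $ i * P $$ (i, j) = stationary_dist P $ j * P $$ (j, i))"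

definition tv_dist :: "real vec \<Rightarrow> real vec \<Rightarrow> real" where
  "tv_dist \<mu> \<nu> = Max ((\<lambda>A. \<bar>(\<Sum>i\<in>A. \<mu> $ i) - (\<Sum>i\<in>A. \<nu> $ i)\<bar>) ` Pow {..<dim_vec \<mu>})"

definition mixing_dist :: "real mat \<Rightarrow> nat \<Rightarrow> real" where
  "mixing_dist P t =
     Max ((\<lambda>i. tv_dist (unit_vec (dim_row P) i \<^sub>v* (P ^\<^sub>m t)) (stationary_dist P)) ` {..<dim_row P})"

definition t_mix :: "real mat \<Rightarrow> real \<Rightarrow> nat" where
  "t_mix P \<epsilon> = (LEAST t. mixing_dist P t \<le> \<epsilon>)"

text \<open>
  Sequences of chains and families of restart probabilities are indexed by \<open>n \<ge> 1\<close>; their values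
  at \<open>0\<close> are irrelevant. The mixing time \<open>t_mix (P n) (1 - \<epsilon>)\<close> is zero
  only for \<open>n \<le> 1 / \<epsilon>\<close>, so the value of division by zero does not affect the limits.
\<close>

definition pre_cutoff :: "(nat \<Rightarrow> real mat) \<Rightarrow> bool" where
  "pre_cutoff P \<longleftrightarrow>
     (SUP \<epsilon>\<in>{0<..<1/2}. limsup (\<lambda>n. ereal (real (t_mix (P n) \<epsilon>) / real (t_mix (P n) (1 - \<epsilon>))))) < \<infinity>"

definition restart_mat :: "real \<Rightarrow> real vec \<Rightarrow> real mat \<Rightarrow> real mat" where
  "restart_mat \<alpha> \<sigma> P =
     (1 - \<alpha>) \<cdot>\<^sub>m P + \<alpha> \<cdot>\<^sub>m (transpose_mat (mat_of_row (vec (dim_row P) (\<lambda>_. 1))) * mat_of_row \<sigma>)"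

text \<open>
  In the second condition a quotient with \<open>t_mix (P n) (1 - \<epsilon>) = 0\<close> also has numerator \<open>0\<close>, and
  \<open>0 / 0 = 0\<close> makes the lower bound vacuous, as it is after clearing denominators.
\<close>

definition coincides_with_mixing_times :: "(nat \<Rightarrow> real mat) \<Rightarrow> (nat \<Rightarrow> real \<Rightarrow> real) \<Rightarrow> bool" where
  "coincides_with_mixing_times P \<alpha> \<longleftrightarrow>
     (SUP \<epsilon>\<in>{0<..<1/2}. liminf (\<lambda>n. ereal (\<alpha> n \<epsilon> * real (t_mix (P n) \<epsilon>)))) = \<infinity> \<and>
     (\<forall>\<epsilon>\<in>{0<..<1/2}. \<forall>\<delta>\<in>{0<..<1/2}. \<forall>n\<ge>1. \<epsilon> \<ge> \<delta> \<longrightarrow>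
        \<alpha> n \<epsilon> / \<alpha> n \<delta> \<in> {real (t_mix (P n) (1 - \<delta>)) / real (t_mix (P n) (1 - \<epsilon>))..1})"

definition restart_sensitive :: "(nat \<Rightarrow> real mat) \<Rightarrow> bool" where
  "restart_sensitive P \<longleftrightarrow>
     (\<forall>\<alpha> :: nat \<Rightarrow> real \<Rightarrow> real.
        (\<forall>n\<ge>1. \<forall>\<epsilon>\<in>{0<..<1/2}. \<alpha> n \<epsilon> \<in> {0<..<1}) \<and> coincides_with_mixing_times P \<alpha> \<longrightarrow>
        (\<exists>\<sigma> :: nat \<Rightarrow> real \<Rightarrow> real vec.
           (\<forall>n\<ge>1. \<forall>\<epsilon>\<in>{0<..<1/2}. \<sigma> n \<epsilon> \<in> prob_vecs n) \<and>
           (\<forall>\<epsilon>\<in>{0<..<1/2}.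
              (\<lambda>n. tv_dist (stationary_dist (P n))
                     (stationary_dist (restart_mat (\<alpha> n \<epsilon>) (\<sigma> n \<epsilon>) (P n)))) \<longlonglongrightarrow> 1)))"

end

(*
  Write t(e) for the e-mixing time and pi' for the stationary distribution of the restarted chain
  with parameter alpha.  Iterating the restart equation gives
    pi' = alpha * sum_{s<m} (1-alpha)^s sigma P^s + (1-alpha)^m pi' P^m.

  (i) Pre-cutoff makes alpha * t(1-d) tend to infinity for every d.  Just before t(1-d) there are a
  start i and a test function f with P^t f(i) > 1-d and pi(f) < d.  By a maximal inequality for
  reversible chains, h = sup_{u<=t} P^u f still has pi(h) <= 3 sqrt d, whereas P^u h(i) > 1-d for
  every u <= t, so h separates pi' from pi when the restarts go to i.

  (ii) For alpha = 1/(2 t(1-e)) the last term above, with m = t(1-e), keeps pi' at distance at most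
  1 - e/2 from pi, whatever sigma is.
*)
theory Submission
  imports Defs "Jordan_Normal_Form.Determinant" "HOL-Library.Indicator_Function"
begin

subsection \<open>Markov operators and means\<close>

text \<open>The restarted stationary law averages the laws of P over all ages since the last
  restart, so a separating function must be large from the start i at every age u <= t, while f is
  known to be large only after exactly t steps. As P^u (P^(t-u) f) = P^t f, it suffices to dominate
  all P^s f with s <= t. A union bound over s would cost a factor growing with t; the maximal
  inequality costs nothing that depends on t. It follows Rota: reversibility makes P^(2s) f a
  conditional expectation of a reversed martingale, which handles even times, and odd times are even
  times for P f.

  The limit 1 is required at each fixed \<epsilon>, so d must tend to 0 while \<alpha> stays at
  \<epsilon>. The hypothesis on \<alpha>, however, makes \<alpha> times the mixing time exceed a
  given bound only at some parameter that depends on the bound. That parameter can be exchanged for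
  \<epsilon> and then for d because pre-cutoff provides one comparison constant valid for all
  parameters.\<close>

definition mean :: "real vec \<Rightarrow> (nat \<Rightarrow> real) \<Rightarrow> real" where
  "mean v f = (\<Sum>i<dim_vec v. v $ i * f i)"

text \<open>Test functions are total functions on the naturals, so powers of the operator are
  iterates \<open>^^\<close> and pointwise arithmetic carries no dimensions. The guards
  \<open>i < n\<close> below keep the matrix indices in range.\<close>

definition markov_op :: "real mat \<Rightarrow> (nat \<Rightarrow> real) \<Rightarrow> nat \<Rightarrow> real" where
  "markov_op P f i = (\<Sum>j<dim_col P. P $$ (i, j) * f j)"

lemma prob_vecsD:
  assumes "p \<in> prob_vecs n"
  shows "p \<in> carrier_vec n" "dim_vec p = n" "\<And>i. i < n \<Longrightarrow> 0 \<le> p $ i" "(\<Sum>i<n. p $ i) = 1"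
  using assms by (auto simp: prob_vecs_def)

lemma stochastic_matsD:
  assumes "P \<in> stochastic_mats n"
  shows "P \<in> carrier_mat n n" "dim_row P = n" "dim_col P = n"
    "\<And>i j. i < n \<Longrightarrow> j < n \<Longrightarrow> 0 \<le> P $$ (i, j)"
    "\<And>i. i < n \<Longrightarrow> (\<Sum>j<n. P $$ (i, j)) = 1"
proof -
  show *: "P \<in> carrier_mat n n" "dim_row P = n" "dim_col P = n"
    using assms by (auto simp: stochastic_mats_def)
  have r: "row P i \<in> prob_vecs n" if "i < n" for i
    using assms that by (auto simp: stochastic_mats_def)
  show "0 \<le> P $$ (i, j)" if "i < n" "j < n" for i j
    using prob_vecsD(3)[OF r[OF that(1)] that(2)] that * by simp
  show "(\<Sum>j<n. P $$ (i, j)) = 1" if "i < n" for i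
    using prob_vecsD(4)[OF r[OF that]] that * by simp
qed

lemma stochastic_matsI:
  assumes "P \<in> carrier_mat n n" "\<And>i j. i < n \<Longrightarrow> j < n \<Longrightarrow> 0 \<le> P $$ (i, j)"
    "\<And>i. i < n \<Longrightarrow> (\<Sum>j<n. P $$ (i, j)) = 1"
  shows "P \<in> stochastic_mats n"
  using assms by (auto simp: stochastic_mats_def prob_vecs_def)

lemma mean_add: "mean v (\<lambda>x. f x + g x) = mean v f + mean v g"
  by (simp add: mean_def distrib_left sum.distrib)

lemma mean_diff: "mean v (\<lambda>x. f x - g x) = mean v f - mean v g"
  by (simp add: mean_def right_diff_distrib sum_subtractf)

lemma mean_cmult: "mean v (\<lambda>x. c * f x) = c * mean v f"
  by (simp add: mean_def sum_distrib_left mult.left_commute)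

lemma mean_const: "p \<in> prob_vecs n \<Longrightarrow> mean p (\<lambda>_. c) = c"
  using prob_vecsD[of p n] by (simp add: mean_def flip: sum_distrib_right)

lemma mean_mono:
  "p \<in> prob_vecs n \<Longrightarrow> (\<And>i. i < n \<Longrightarrow> f i \<le> g i) \<Longrightarrow> mean p f \<le> mean p g"
  using prob_vecsD[of p n] by (auto simp: mean_def intro!: sum_mono mult_left_mono)

lemma mean_cong: "dim_vec p = n \<Longrightarrow> (\<And>i. i < n \<Longrightarrow> f i = g i) \<Longrightarrow> mean p f = mean p g"
  by (simp add: mean_def)

lemma mean_nonneg: "p \<in> prob_vecs n \<Longrightarrow> (\<And>i. i < n \<Longrightarrow> 0 \<le> f i) \<Longrightarrow> 0 \<le> mean p f"
  using mean_mono[of p n "\<lambda>_. 0" f] by (simp add: mean_def)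

lemma mean_unit_vec: "i < n \<Longrightarrow> mean (unit_vec n i) f = f i"
  by (simp add: mean_def if_distrib[of "\<lambda>x. x * _"] cong: if_cong)

lemma unit_vec_prob: "i < n \<Longrightarrow> unit_vec n i \<in> prob_vecs n"
  by (auto simp: prob_vecs_def)

lemma markov_op_cong:
  "dim_col P = n \<Longrightarrow> (\<And>j. j < n \<Longrightarrow> f j = g j) \<Longrightarrow> markov_op P f i = markov_op P g i"
  by (simp add: markov_op_def)

lemma markov_op_const: "P \<in> stochastic_mats n \<Longrightarrow> i < n \<Longrightarrow> markov_op P (\<lambda>_. c) i = c"
  using stochastic_matsD[of P n] by (simp add: markov_op_def flip: sum_distrib_right)

lemma markov_op_mono:
  "P \<in> stochastic_mats n \<Longrightarrow> i < n \<Longrightarrow> (\<And>j. j < n \<Longrightarrow> f j \<le> g j) \<Longrightarrow> markov_op P f i \<le> markov_op P g i"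
  using stochastic_matsD[of P n] by (auto simp: markov_op_def intro!: sum_mono mult_left_mono)

lemma markov_op_pow_mono:
  assumes "P \<in> stochastic_mats n" "\<And>j. j < n \<Longrightarrow> f j \<le> g j" "i < n"
  shows "(markov_op P ^^ t) f i \<le> (markov_op P ^^ t) g i"
  using assms(3) by (induction t arbitrary: i) (auto simp: assms(2) intro!: markov_op_mono[OF assms(1)])

lemma markov_op_pow_add:
  assumes "dim_col P = n" "i < n"
  shows "(markov_op P ^^ t) (\<lambda>x. f x + g x) i = (markov_op P ^^ t) f i + (markov_op P ^^ t) g i"
  using assms(2)
proof (induction t arbitrary: i)
  case (Suc t)
  then show ?case
    by (simp add: markov_op_def assms(1) distrib_left sum.distrib)
qed simp

lemma markov_op_pow_const:
  assumes "P \<in> stochastic_mats n" "i < n"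
  shows "(markov_op P ^^ t) (\<lambda>_. c) i = c"
  using assms(2)
proof (induction t arbitrary: i)
  case (Suc t)
  then have "markov_op P ((markov_op P ^^ t) (\<lambda>_. c)) i = markov_op P (\<lambda>_. c) i"
    by (intro markov_op_cong[OF stochastic_matsD(3)[OF assms(1)]] Suc.IH)
  with Suc show ?case by (simp add: markov_op_const[OF assms(1)])
qed simp

lemma markov_op_pow_bounds:
  assumes "P \<in> stochastic_mats n" "\<And>j. j < n \<Longrightarrow> a \<le> f j \<and> f j \<le> b" "i < n"
  shows "a \<le> (markov_op P ^^ t) f i" "(markov_op P ^^ t) f i \<le> b"
  using markov_op_pow_mono[OF assms(1), of "\<lambda>_. a" f i t]
    markov_op_pow_mono[OF assms(1), of f "\<lambda>_. b" i t]
    assms markov_op_pow_const[OF assms(1,3)] by auto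

lemma vec_mult_mat_index:
  "v \<in> carrier_vec n \<Longrightarrow> A \<in> carrier_mat n m \<Longrightarrow> j < m \<Longrightarrow>
    (v \<^sub>v* A) $ j = (\<Sum>i<n. v $ i * A $$ (i, j))"
  by (auto simp: vec_mult_mat_def scalar_prod_def atLeast0LessThan)

lemma dim_vec_mult_mat [simp]: "dim_vec (v \<^sub>v* A) = dim_col A"
  by (simp add: vec_mult_mat_def)

lemma mean_vec_mult_mat:
  assumes "v \<in> carrier_vec n" "A \<in> carrier_mat n m"
  shows "mean (v \<^sub>v* A) f = mean v (markov_op A f)"
proof -
  have "mean (v \<^sub>v* A) f = (\<Sum>j<m. (\<Sum>i<n. v $ i * A $$ (i, j)) * f j)"
    using assms by (simp add: mean_def vec_mult_mat_index)
  also have "\<dots> = (\<Sum>i<n. \<Sum>j<m. v $ i * A $$ (i, j) * f j)"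
    unfolding sum_distrib_right by (rule sum.swap)
  also have "\<dots> = mean v (markov_op A f)"
    using assms by (simp add: mean_def markov_op_def sum_distrib_left mult.assoc)
  finally show ?thesis .
qed

lemma markov_op_mat_mult:
  assumes "A \<in> carrier_mat n n" "B \<in> carrier_mat n n" "i < n"
  shows "markov_op (A * B) f i = markov_op A (markov_op B f) i"
proof -
  have "markov_op (A * B) f i = (\<Sum>j<n. (\<Sum>k<n. A $$ (i, k) * B $$ (k, j)) * f j)"
    using assms by (auto simp: markov_op_def scalar_prod_def atLeast0LessThan intro!: sum.cong)
  also have "\<dots> = (\<Sum>k<n. \<Sum>j<n. A $$ (i, k) * B $$ (k, j) * f j)"
    unfolding sum_distrib_right by (rule sum.swap)
  also have "\<dots> = markov_op A (markov_op B f) i"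
    using assms by (simp add: markov_op_def sum_distrib_left mult.assoc)
  finally show ?thesis .
qed

lemma markov_op_mat_pow:
  assumes "P \<in> carrier_mat n n" "i < n"
  shows "markov_op (P ^\<^sub>m t) f i = (markov_op P ^^ t) f i"
  using assms(2)
proof (induction t arbitrary: f i)
  case 0
  have "markov_op (1\<^sub>m n) f i = (\<Sum>j<n. (if i = j then 1 else 0) * f j)"
    using 0 by (simp add: markov_op_def)
  also have "\<dots> = f i"
    using 0 by (simp add: if_distrib[of "\<lambda>x. x * _"] cong: if_cong)
  finally show ?case using assms by simp
next
  case (Suc t)
  have "markov_op (P ^\<^sub>m Suc t) f i = markov_op (P ^\<^sub>m t) (markov_op P f) i"
    using assms Suc.prems by (simp add: markov_op_mat_mult[of _ n])
  also have "\<dots> = (markov_op P ^^ t) (markov_op P f) i"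
    using Suc by blast
  finally show ?case by (simp add: funpow_swap1)
qed

lemma stochastic_mat_pow:
  assumes "P \<in> stochastic_mats n"
  shows "P ^\<^sub>m t \<in> stochastic_mats n"
proof (rule stochastic_matsI)
  note P = stochastic_matsD[OF assms]
  show C: "P ^\<^sub>m t \<in> carrier_mat n n" using P by simp
  show "(\<Sum>j<n. (P ^\<^sub>m t) $$ (i, j)) = 1" if "i < n" for i
    using markov_op_mat_pow[OF P(1) that, of t "\<lambda>_. 1"] carrier_matD(2)[OF C]
    by (simp add: markov_op_pow_const[OF assms that] markov_op_def del: pow_mat_dim)
  show "0 \<le> (P ^\<^sub>m t) $$ (i, j)" if "i < n" "j < n" for i j
  proof -
    have "(P ^\<^sub>m t) $$ (i, j) = markov_op (P ^\<^sub>m t) (\<lambda>k. if k = j then 1 else 0) i"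
      using carrier_matD(2)[OF C] that
      by (simp add: markov_op_def if_distrib[of "\<lambda>x. _ * x"] del: pow_mat_dim cong: if_cong)
    also have "\<dots> \<ge> 0"
      unfolding markov_op_mat_pow[OF P(1) that(1)]
      by (rule markov_op_pow_bounds[OF assms, where b = 1]) (use that in auto)
    finally show ?thesis .
  qed
qed

lemma prob_vec_mult_mat:
  assumes "p \<in> prob_vecs n" "P \<in> stochastic_mats n"
  shows "p \<^sub>v* P \<in> prob_vecs n"
proof -
  note p = prob_vecsD[OF assms(1)] and P = stochastic_matsD[OF assms(2)]
  have "(\<Sum>i<n. (p \<^sub>v* P) $ i) = mean (p \<^sub>v* P) (\<lambda>_. 1)"
    using P by (simp add: mean_def)
  also have "\<dots> = mean p (markov_op P (\<lambda>_. 1))"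
    using p P by (simp add: mean_vec_mult_mat)
  also have "\<dots> = mean p (\<lambda>_. 1)"
    by (rule mean_cong[OF p(2)]) (rule markov_op_const[OF assms(2)])
  also have "\<dots> = 1" by (rule mean_const[OF assms(1)])
  finally show ?thesis
    using p P by (auto simp: prob_vecs_def vec_mult_mat_index intro!: carrier_vecI sum_nonneg)
qed

lemma mean_unit_vec_mat_pow:
  assumes "P \<in> carrier_mat n n" "i < n"
  shows "mean (unit_vec n i \<^sub>v* (P ^\<^sub>m t)) f = (markov_op P ^^ t) f i"
  using assms by (simp add: mean_vec_mult_mat[of _ n _ n] mean_unit_vec markov_op_mat_pow)

lemma mean_stationary:
  assumes "p \<in> prob_vecs n" "P \<in> stochastic_mats n" "p \<^sub>v* P = p"
  shows "mean p (markov_op P f) = mean p f"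
  using mean_vec_mult_mat[OF prob_vecsD(1)[OF assms(1)] stochastic_matsD(1)[OF assms(2)], of f] assms(3)
  by simp

lemma mean_stationary_pow:
  assumes "p \<in> prob_vecs n" "P \<in> stochastic_mats n" "p \<^sub>v* P = p"
  shows "mean p ((markov_op P ^^ t) f) = mean p f"
  by (induction t) (simp_all add: mean_stationary[OF assms])

subsection \<open>Total variation distance\<close>

lemma sum_eq_mean_indicator:
  assumes "A \<subseteq> {..<dim_vec v}"
  shows "(\<Sum>i\<in>A. v $ i) = mean v (indicator A)"
proof -
  have "mean v (indicator A) = (\<Sum>i<dim_vec v. if i \<in> A then v $ i else 0)"
    unfolding mean_def by (intro sum.cong) (auto simp: indicator_def)
  also have "\<dots> = (\<Sum>i\<in>{..<dim_vec v} \<inter> A. v $ i)"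
    by (simp add: sum.inter_restrict)
  finally show ?thesis using assms by (simp add: Int_absorb1)
qed

text \<open>Passing to 1 - f exchanges the two distributions, so one-sided estimates over all
  [0,1]-valued f give both signs.\<close>

lemma mean_compl:
  assumes "\<mu> \<in> prob_vecs n" "\<nu> \<in> prob_vecs n"
  shows "mean \<mu> (\<lambda>x. 1 - f x) - mean \<nu> (\<lambda>x. 1 - f x) = mean \<nu> f - mean \<mu> f"
  by (simp add: mean_diff mean_const[OF assms(1)] mean_const[OF assms(2)])

lemma tv_dist_ge_mean_diff:
  assumes "\<mu> \<in> prob_vecs n" "\<nu> \<in> prob_vecs n" "\<And>i. i < n \<Longrightarrow> 0 \<le> f i \<and> f i \<le> 1"
  shows "mean \<mu> f - mean \<nu> f \<le> tv_dist \<mu> \<nu>"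
proof -
  note d = prob_vecsD(2)[OF assms(1)] prob_vecsD(2)[OF assms(2)]
  define A where "A = {i. i < n \<and> \<nu> $ i < \<mu> $ i}"
  have A: "A \<subseteq> {..<n}" by (auto simp: A_def)
  have "mean \<mu> f - mean \<nu> f = (\<Sum>i<n. (\<mu> $ i - \<nu> $ i) * f i)"
    by (simp add: mean_def d left_diff_distrib sum_subtractf)
  also have "\<dots> \<le> (\<Sum>i<n. (\<mu> $ i - \<nu> $ i) * indicator A i)"
  proof (rule sum_mono)
    fix i assume "i \<in> {..<n}"
    then have i: "i < n" by simp
    show "(\<mu> $ i - \<nu> $ i) * f i \<le> (\<mu> $ i - \<nu> $ i) * indicator A i"
    proof (cases "i \<in> A")
      case True
      then show ?thesis
        using assms(3)[OF i] mult_left_mono[of "f i" 1 "\<mu> $ i - \<nu> $ i"] by (simp add: A_def)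
    next
      case False
      then show ?thesis
        using assms(3)[OF i] i by (simp add: A_def mult_nonpos_nonneg)
    qed
  qed
  also have "\<dots> = (\<Sum>i\<in>A. \<mu> $ i) - (\<Sum>i\<in>A. \<nu> $ i)"
    using sum_eq_mean_indicator[of A \<mu>] sum_eq_mean_indicator[of A \<nu>] A
    by (simp add: d mean_def left_diff_distrib sum_subtractf)
  also have "\<dots> \<le> \<bar>(\<Sum>i\<in>A. \<mu> $ i) - (\<Sum>i\<in>A. \<nu> $ i)\<bar>" by simp
  also have "\<dots> \<le> tv_dist \<mu> \<nu>"
    unfolding tv_dist_def by (rule Max_ge) (use A d in auto)
  finally show ?thesis .
qed

lemma tv_dist_attained:
  assumes "\<mu> \<in> prob_vecs n" "\<nu> \<in> prob_vecs n"
  obtains f where "\<And>i. 0 \<le> f i \<and> f i \<le> 1" "tv_dist \<mu> \<nu> = mean \<mu> f - mean \<nu> f"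
proof -
  note d = prob_vecsD(2)[OF assms(1)] prob_vecsD(2)[OF assms(2)]
  have "tv_dist \<mu> \<nu> \<in> (\<lambda>A. \<bar>(\<Sum>i\<in>A. \<mu> $ i) - (\<Sum>i\<in>A. \<nu> $ i)\<bar>) ` Pow {..<dim_vec \<mu>}"
    unfolding tv_dist_def by (rule Max_in) auto
  then obtain A where A: "A \<subseteq> {..<n}" "tv_dist \<mu> \<nu> = \<bar>mean \<mu> (indicator A) - mean \<nu> (indicator A)\<bar>"
    using sum_eq_mean_indicator[of _ \<mu>] sum_eq_mean_indicator[of _ \<nu>] d by auto
  show ?thesis
  proof (cases "mean \<mu> (indicator A) \<ge> mean \<nu> (indicator A)")
    case True
    then show ?thesis using that[of "indicator A"] A by (auto simp: indicator_def)
  next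
    case False
    then have "tv_dist \<mu> \<nu> = mean \<mu> (\<lambda>x. 1 - indicator A x) - mean \<nu> (\<lambda>x. 1 - indicator A x)"
      unfolding mean_compl[OF assms] A(2) by simp
    then show ?thesis by (intro that[of "\<lambda>x. 1 - indicator A x"]) (auto simp: indicator_def)
  qed
qed

lemma tv_dist_le_1:
  assumes "\<mu> \<in> prob_vecs n" "\<nu> \<in> prob_vecs n"
  shows "tv_dist \<mu> \<nu> \<le> 1"
proof -
  obtain f where f: "\<And>i. 0 \<le> f i \<and> f i \<le> 1" "tv_dist \<mu> \<nu> = mean \<mu> f - mean \<nu> f"
    using tv_dist_attained[OF assms] by blast
  have "mean \<mu> f \<le> 1" using mean_mono[OF assms(1), of f "\<lambda>_. 1"] mean_const[OF assms(1)] f by simp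
  moreover have "0 \<le> mean \<nu> f" using mean_nonneg[OF assms(2)] f by simp
  ultimately show ?thesis using f by simp
qed

subsection \<open>Stationary distributions\<close>

text \<open>
  If \<open>v P \<ge> v \<ge> 0\<close>, equality holds because both sides have the same total mass.
\<close>

lemma subinvariant_eq:
  assumes P: "P \<in> stochastic_mats n"
    and le: "\<And>j. j < n \<Longrightarrow> w j \<le> (\<Sum>i<n. w i * P $$ (i, j))" and j: "j < n"
  shows "(\<Sum>i<n. w i * P $$ (i, j)) = w j"
proof -
  note P = stochastic_matsD[OF P]
  let ?d = "\<lambda>j. (\<Sum>i<n. w i * P $$ (i, j)) - w j"
  have "(\<Sum>j<n. \<Sum>i<n. w i * P $$ (i, j)) = (\<Sum>i<n. \<Sum>j<n. w i * P $$ (i, j))"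
    by (rule sum.swap)
  also have "\<dots> = (\<Sum>i<n. w i)" using P by (simp flip: sum_distrib_left)
  finally have "(\<Sum>j<n. ?d j) = 0" by (simp add: sum_subtractf)
  then have "\<forall>j\<in>{..<n}. ?d j = 0"
    using le by (subst (asm) sum_nonneg_eq_0_iff) auto
  then show ?thesis using j by auto
qed

text \<open>P - 1 kills the constant vector, hence is singular, and its transpose has a kernel
  vector v, possibly of mixed sign. By the triangle inequality the absolute values of v are
  subinvariant, so they are invariant and can be normalized.\<close>

lemma ex_stationary:
  assumes P: "P \<in> stochastic_mats n" and n: "n \<ge> 1"
  obtains p where "p \<in> prob_vecs n" "p \<^sub>v* P = p"
proof -
  note PD = stochastic_matsD[OF P]
  let ?A = "P - 1\<^sub>m n"
  have A: "?A \<in> carrier_mat n n" by (simp add: minus_carrier_mat)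
  let ?u = "vec n (\<lambda>_. 1 :: real)"
  have "?A *\<^sub>v ?u = 0\<^sub>v n"
  proof (rule eq_vecI)
    fix i assume "i < dim_vec (0\<^sub>v n :: real vec)"
    then have i: "i < n" by simp
    have "(?A *\<^sub>v ?u) $ i = (\<Sum>j<n. P $$ (i, j) - (if i = j then 1 else 0))"
      using i PD by (auto simp: scalar_prod_def atLeast0LessThan intro!: sum.cong)
    also have "\<dots> = 0" using i PD by (simp add: sum_subtractf)
    finally show "(?A *\<^sub>v ?u) $ i = 0\<^sub>v n $ i" using i by simp
  qed (use PD in auto)
  moreover have "?u \<noteq> 0\<^sub>v n"
  proof
    assume "?u = 0\<^sub>v n"
    then have "?u $ 0 = (0\<^sub>v n :: real vec) $ 0" by simp
    with n show False by simp
  qed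
  moreover have "?u \<in> carrier_vec n" by simp
  ultimately have "det ?A = 0"
    using det_0_iff_vec_prod_zero[OF A] by blast
  then have "det (transpose_mat ?A) = 0" using det_transpose[OF A] by simp
  then obtain v where v: "v \<in> carrier_vec n" "v \<noteq> 0\<^sub>v n" "transpose_mat ?A *\<^sub>v v = 0\<^sub>v n"
    using det_0_iff_vec_prod_zero[of "transpose_mat ?A" n] A by auto
  have inv: "(\<Sum>i<n. v $ i * P $$ (i, j)) = v $ j" if j: "j < n" for j
  proof -
    have "0 = (transpose_mat ?A *\<^sub>v v) $ j" unfolding v(3) using j by simp
    also have "\<dots> = (\<Sum>i<n. (P $$ (i, j) - (if i = j then 1 else 0)) * v $ i)"
      using j PD(1,2,3) v(1) by (auto simp: scalar_prod_def atLeast0LessThan intro!: sum.cong)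
    also have "\<dots> = (\<Sum>i<n. v $ i * P $$ (i, j) - (if i = j then v $ i else 0))"
      by (intro sum.cong) (auto simp: algebra_simps)
    also have "\<dots> = (\<Sum>i<n. v $ i * P $$ (i, j)) - v $ j"
      using j by (simp add: sum_subtractf)
    finally show ?thesis by simp
  qed
  let ?w = "\<lambda>i. \<bar>v $ i\<bar>"
  have w: "(\<Sum>i<n. ?w i * P $$ (i, j)) = ?w j" if j: "j < n" for j
  proof (rule subinvariant_eq[OF P _ j])
    fix j assume j: "j < n"
    have "?w j = \<bar>\<Sum>i<n. v $ i * P $$ (i, j)\<bar>" using inv[OF j] by simp
    also have "\<dots> \<le> (\<Sum>i<n. \<bar>v $ i * P $$ (i, j)\<bar>)" by (rule sum_abs)
    also have "\<dots> = (\<Sum>i<n. ?w i * P $$ (i, j))"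
      using PD j by (intro sum.cong) (auto simp: abs_mult)
    finally show "?w j \<le> (\<Sum>i<n. ?w i * P $$ (i, j))" .
  qed
  define s where "s = (\<Sum>i<n. ?w i)"
  have "s \<noteq> 0"
  proof
    assume "s = 0"
    then have "\<forall>i\<in>{..<n}. v $ i = 0" unfolding s_def by (subst (asm) sum_nonneg_eq_0_iff) auto
    with v(1,2) show False by (auto intro!: eq_vecI)
  qed
  moreover have "s \<ge> 0" by (simp add: s_def sum_nonneg)
  ultimately have s: "s > 0" by simp
  define p where "p = vec n (\<lambda>i. ?w i / s)"
  have "p \<in> prob_vecs n"
    using s by (auto simp: p_def prob_vecs_def simp flip: sum_divide_distrib s_def)
  moreover have "p \<^sub>v* P = p"
  proof (rule eq_vecI)
    fix j assume "j < dim_vec p"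
    then have j: "j < n" by (simp add: p_def)
    have "(p \<^sub>v* P) $ j = (\<Sum>i<n. ?w i * P $$ (i, j)) / s"
      using PD j by (subst vec_mult_mat_index[of _ n _ n]) (auto simp: p_def sum_divide_distrib)
    then show "(p \<^sub>v* P) $ j = p $ j" using w[OF j] j by (simp add: p_def)
  qed (use PD in \<open>auto simp: p_def\<close>)
  ultimately show ?thesis using that by blast
qed

text \<open>Invariance passes from P to its powers, and a power with positive entry (k, j) carries
  mass from k to j.\<close>

lemma irreducible_positive:
  assumes P: "P \<in> stochastic_mats n" and irr: "irreducible_chain P"
    and w0: "\<And>i. i < n \<Longrightarrow> 0 \<le> w i" and k: "k < n" "0 < w k"
    and inv: "\<And>j. j < n \<Longrightarrow> (\<Sum>i<n. w i * P $$ (i, j)) = w j" and j: "j < n"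
  shows "0 < w j"
proof -
  note PD = stochastic_matsD[OF P]
  have pow: "vec n w \<^sub>v* (P ^\<^sub>m t) = vec n w" for t
  proof -
    have *: "mean (vec n w) (markov_op P f) = mean (vec n w) f" for f
    proof -
      have "vec n w \<^sub>v* P = vec n w"
        using PD inv by (auto intro!: eq_vecI simp: vec_mult_mat_index[of _ n _ n])
      then show ?thesis using mean_vec_mult_mat[of "vec n w" n P n f] PD by simp
    qed
    have **: "mean (vec n w) ((markov_op P ^^ t) f) = mean (vec n w) f" for f
      by (induction t) (simp_all add: *)
    have "mean (vec n w \<^sub>v* (P ^\<^sub>m t)) f = mean (vec n w) f" for f
    proof -
      have "mean (vec n w \<^sub>v* (P ^\<^sub>m t)) f = mean (vec n w) (markov_op (P ^\<^sub>m t) f)"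
        using PD(1) by (intro mean_vec_mult_mat[of _ n _ n]) auto
      also have "\<dots> = mean (vec n w) ((markov_op P ^^ t) f)"
        by (rule mean_cong[of _ n]) (simp_all add: markov_op_mat_pow[OF PD(1)])
      finally show ?thesis by (simp only: **)
    qed
    note eq = this
    have d: "dim_col (P ^\<^sub>m t) = n" by (rule stochastic_matsD(3)[OF stochastic_mat_pow[OF P]])
    show ?thesis
    proof (rule eq_vecI)
      fix j assume "j < dim_vec (vec n w)"
      then show "(vec n w \<^sub>v* (P ^\<^sub>m t)) $ j = vec n w $ j"
        using eq[of "\<lambda>i. if i = j then 1 else 0"]
        by (simp add: mean_def d if_distrib[of "\<lambda>x. _ * x"] del: pow_mat_dim cong: if_cong)
    qed (simp add: d del: pow_mat_dim)
  qed
  obtain t where t: "(P ^\<^sub>m t) $$ (k, j) > 0"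
    using irr k(1) j PD(2) unfolding irreducible_chain_def by blast
  note Q = stochastic_matsD[OF stochastic_mat_pow[OF P, of t]]
  have "0 < w k * (P ^\<^sub>m t) $$ (k, j)" using t k by simp
  also have "\<dots> \<le> (\<Sum>i<n. w i * (P ^\<^sub>m t) $$ (i, j))"
    using k j w0 Q by (intro member_le_sum[where f = "\<lambda>i. w i * (P ^\<^sub>m t) $$ (i, j)"]) auto
  also have "\<dots> = (vec n w \<^sub>v* (P ^\<^sub>m t)) $ j"
    using j Q by (subst vec_mult_mat_index[of _ n _ n]) auto
  also have "\<dots> = w j" using pow j by simp
  finally show ?thesis .
qed

text \<open>If p exceeds q at k, the positive part of p - q is subinvariant, so invariant, so
  positive at every state by irreducibility. Then p > q everywhere, although both have mass
  1.\<close>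

lemma stationary_le:
  assumes P: "P \<in> stochastic_mats n" and irr: "irreducible_chain P"
    and p: "p \<in> prob_vecs n" "p \<^sub>v* P = p" and q: "q \<in> prob_vecs n" "q \<^sub>v* P = q"
    and k: "k < n"
  shows "p $ k \<le> q $ k"
proof (rule ccontr)
  assume neg: "\<not> p $ k \<le> q $ k"
  note PD = stochastic_matsD[OF P]
  let ?w = "\<lambda>i. max 0 (p $ i - q $ i)"
  have inv: "(\<Sum>i<n. (p $ i - q $ i) * P $$ (i, j)) = p $ j - q $ j" if "j < n" for j
    using vec_mult_mat_index[OF prob_vecsD(1)[OF p(1)] PD(1) that]
      vec_mult_mat_index[OF prob_vecsD(1)[OF q(1)] PD(1) that] p(2) q(2)
    by (simp add: left_diff_distrib sum_subtractf)
  have w: "(\<Sum>i<n. ?w i * P $$ (i, j)) = ?w j" if j: "j < n" for j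
  proof (rule subinvariant_eq[OF P _ j])
    fix j assume j: "j < n"
    have "p $ j - q $ j \<le> (\<Sum>i<n. ?w i * P $$ (i, j))"
      unfolding inv[OF j, symmetric] using PD j by (intro sum_mono mult_right_mono) auto
    moreover have "0 \<le> (\<Sum>i<n. ?w i * P $$ (i, j))"
      using PD j by (intro sum_nonneg mult_nonneg_nonneg) auto
    ultimately show "?w j \<le> (\<Sum>i<n. ?w i * P $$ (i, j))" by simp
  qed
  have "0 < ?w j" if "j < n" for j
    by (rule irreducible_positive[OF P irr _ k _ w that]) (use neg in auto)
  then have "q $ j < p $ j" if "j < n" for j
    using that by (fastforce simp: less_max_iff_disj)
  then have "(\<Sum>j<n. q $ j) < (\<Sum>j<n. p $ j)"
    using k by (intro sum_strict_mono) auto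
  then show False using prob_vecsD(4)[OF p(1)] prob_vecsD(4)[OF q(1)] by simp
qed

lemma stationary_dist:
  assumes "P \<in> ergodic_mats n" "n \<ge> 1"
  shows "stationary_dist P \<in> prob_vecs n" "stationary_dist P \<^sub>v* P = stationary_dist P"
proof -
  have P: "P \<in> stochastic_mats n" "irreducible_chain P" "dim_row P = n"
    using assms(1) stochastic_matsD by (auto simp: ergodic_mats_def)
  have "\<exists>!p. p \<in> prob_vecs n \<and> p \<^sub>v* P = p"
  proof (rule ex_ex1I)
    show "\<exists>p. p \<in> prob_vecs n \<and> p \<^sub>v* P = p" using ex_stationary[OF P(1) assms(2)] by metis
    fix p q assume "p \<in> prob_vecs n \<and> p \<^sub>v* P = p" "q \<in> prob_vecs n \<and> q \<^sub>v* P = q"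
    then show "p = q"
      using stationary_le[OF P(1,2), of p q] stationary_le[OF P(1,2), of q p]
        prob_vecsD(2)[of p n] prob_vecsD(2)[of q n]
      by (intro eq_vecI order.antisym) auto
  qed
  from theI'[OF this]
  show "stationary_dist P \<in> prob_vecs n" "stationary_dist P \<^sub>v* P = stationary_dist P"
    by (simp_all add: stationary_dist_def P(3))
qed

subsection \<open>Restart perturbations\<close>

lemma restart_mat_index:
  assumes "P \<in> carrier_mat n n" "\<sigma> \<in> carrier_vec n" "i < n" "j < n"
  shows "restart_mat \<alpha> \<sigma> P $$ (i, j) = (1 - \<alpha>) * P $$ (i, j) + \<alpha> * \<sigma> $ j"
  using assms by (auto simp: restart_mat_def scalar_prod_def mat_of_row_def)

lemma restart_mat_carrier:
  assumes "P \<in> carrier_mat n n" "\<sigma> \<in> carrier_vec n"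
  shows "restart_mat \<alpha> \<sigma> P \<in> carrier_mat n n"
  using assms by (auto simp: restart_mat_def mat_of_row_def)

lemma restart_mat_stochastic:
  assumes P: "P \<in> stochastic_mats n" and s: "\<sigma> \<in> prob_vecs n" and a: "\<alpha> \<in> {0<..<1}"
  shows "restart_mat \<alpha> \<sigma> P \<in> stochastic_mats n"
proof (rule stochastic_matsI)
  note PD = stochastic_matsD[OF P] and sD = prob_vecsD[OF s]
  note idx = restart_mat_index[OF PD(1) sD(1)]
  show "restart_mat \<alpha> \<sigma> P \<in> carrier_mat n n" by (rule restart_mat_carrier[OF PD(1) sD(1)])
  show "0 \<le> restart_mat \<alpha> \<sigma> P $$ (i, j)" if "i < n" "j < n" for i j
    using that a PD sD by (simp add: idx)
  show "(\<Sum>j<n. restart_mat \<alpha> \<sigma> P $$ (i, j)) = 1" if "i < n" for i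
    using that a PD sD by (simp add: idx sum.distrib flip: sum_distrib_left)
qed

lemma markov_op_restart_mat:
  assumes P: "P \<in> stochastic_mats n" and s: "\<sigma> \<in> prob_vecs n" and i: "i < n"
  shows "markov_op (restart_mat \<alpha> \<sigma> P) f i = (1 - \<alpha>) * markov_op P f i + \<alpha> * mean \<sigma> f"
proof -
  note PD = stochastic_matsD[OF P] and sD = prob_vecsD[OF s]
  note idx = restart_mat_index[OF PD(1) sD(1)]
  show ?thesis
    using i restart_mat_carrier[OF PD(1) sD(1), of \<alpha>] PD sD
    by (simp add: markov_op_def mean_def idx distrib_right sum.distrib sum_distrib_left mult.assoc)
qed

text \<open>Uniqueness comes from contraction: when the difference of two fixed points is tested
  against its own sign, the restart terms cancel and the l1 distance is at most 1 - \<alpha> times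
  itself. The second conclusion is the one-step equation that is iterated later.\<close>

lemma restart_stationary:
  assumes P: "P \<in> stochastic_mats n" and n: "n \<ge> 1" and s: "\<sigma> \<in> prob_vecs n" and a: "\<alpha> \<in> {0<..<1}"
  defines "p \<equiv> stationary_dist (restart_mat \<alpha> \<sigma> P)"
  shows "p \<in> prob_vecs n" "mean p f = (1 - \<alpha>) * mean p (markov_op P f) + \<alpha> * mean \<sigma> f"
proof -
  let ?R = "restart_mat \<alpha> \<sigma> P"
  note PD = stochastic_matsD[OF P] and R = restart_mat_stochastic[OF P s a]
  have eq: "mean p f = (1 - \<alpha>) * mean p (markov_op P f) + \<alpha> * mean \<sigma> f"
    if "p \<in> prob_vecs n" "p \<^sub>v* ?R = p" for p f
  proof -
    have "mean p f = mean p (markov_op ?R f)" using mean_stationary[OF that(1) R that(2)] by simp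
    also have "\<dots> = mean p (\<lambda>x. (1 - \<alpha>) * markov_op P f x + \<alpha> * mean \<sigma> f)"
      by (rule mean_cong[OF prob_vecsD(2)[OF that(1)]]) (rule markov_op_restart_mat[OF P s])
    finally show ?thesis by (simp add: mean_add mean_cmult mean_const[OF that(1)])
  qed
  have "\<exists>!p. p \<in> prob_vecs n \<and> p \<^sub>v* ?R = p"
  proof (rule ex_ex1I)
    show "\<exists>p. p \<in> prob_vecs n \<and> p \<^sub>v* ?R = p" using ex_stationary[OF R n] by metis
    fix p q assume pq: "p \<in> prob_vecs n \<and> p \<^sub>v* ?R = p" "q \<in> prob_vecs n \<and> q \<^sub>v* ?R = q"
    let ?f = "\<lambda>i. sgn (p $ i - q $ i)"
    let ?S = "\<Sum>i<n. \<bar>p $ i - q $ i\<bar>"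
    have d: "dim_vec p = n" "dim_vec q = n" using pq prob_vecsD(2) by blast+
    have "?S = mean p ?f - mean q ?f"
      by (simp add: mean_def d flip: sum_subtractf left_diff_distrib)
         (simp add: abs_sgn)
    also have "\<dots> = (1 - \<alpha>) * (mean p (markov_op P ?f) - mean q (markov_op P ?f))"
      using eq[of p ?f] eq[of q ?f] pq by (simp add: algebra_simps)
    also have "mean p (markov_op P ?f) - mean q (markov_op P ?f)
        = (\<Sum>i<n. (p $ i - q $ i) * markov_op P ?f i)"
      by (simp add: mean_def d sum_subtractf left_diff_distrib)
    also have "\<dots> \<le> ?S"
    proof (rule sum_mono)
      fix i assume "i \<in> {..<n}"
      then have "-1 \<le> markov_op P ?f i" "markov_op P ?f i \<le> 1"
        using markov_op_pow_bounds[OF P, of "-1" ?f 1 i 1] by (auto simp: sgn_if)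
      then have "\<bar>markov_op P ?f i\<bar> \<le> 1" by auto
      then have "\<bar>p $ i - q $ i\<bar> * \<bar>markov_op P ?f i\<bar> \<le> \<bar>p $ i - q $ i\<bar> * 1"
        by (intro mult_left_mono) auto
      then show "(p $ i - q $ i) * markov_op P ?f i \<le> \<bar>p $ i - q $ i\<bar>"
        by (simp flip: abs_mult)
    qed
    finally have "?S \<le> (1 - \<alpha>) * ?S" using a by simp
    then have "\<alpha> * ?S \<le> 0" by (simp add: algebra_simps)
    then have "?S \<le> 0" using a by (simp add: mult_le_0_iff)
    then have "?S = 0" by (intro antisym) (auto intro: sum_nonneg)
    then have "\<forall>i\<in>{..<n}. \<bar>p $ i - q $ i\<bar> = 0" by (subst (asm) sum_nonneg_eq_0_iff) auto
    then show "p = q" using d by (auto intro!: eq_vecI)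
  qed
  from theI'[OF this] have *: "p \<in> prob_vecs n" "p \<^sub>v* ?R = p"
    using stochastic_matsD(2)[OF R] by (simp_all add: p_def stationary_dist_def)
  show "p \<in> prob_vecs n" by fact
  show "mean p f = (1 - \<alpha>) * mean p (markov_op P f) + \<alpha> * mean \<sigma> f" using eq[OF *] .
qed

subsection \<open>Mixing\<close>

lemma mixing_dist_le_iff:
  assumes "P \<in> ergodic_mats n" "n \<ge> 1"
  shows "mixing_dist P t \<le> c \<longleftrightarrow>
    (\<forall>i<n. tv_dist (unit_vec n i \<^sub>v* (P ^\<^sub>m t)) (stationary_dist P) \<le> c)"
proof -
  have "dim_row P = n" using assms(1) stochastic_matsD(2) by (auto simp: ergodic_mats_def)
  then show ?thesis using assms(2) unfolding mixing_dist_def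
    by (subst Max_le_iff) (auto simp: lessThan_empty_iff)
qed

lemma mixing_dist_le_D:
  assumes "P \<in> ergodic_mats n" "n \<ge> 1" "mixing_dist P t \<le> c" "i < n"
    and "\<And>j. j < n \<Longrightarrow> 0 \<le> f j \<and> f j \<le> 1"
  shows "mean (stationary_dist P) f - (markov_op P ^^ t) f i \<le> c"
proof -
  note \<pi> = stationary_dist(1)[OF assms(1,2)]
  have P: "P \<in> stochastic_mats n" using assms(1) by (simp add: ergodic_mats_def)
  note u = prob_vec_mult_mat[OF unit_vec_prob[OF assms(4)] stochastic_mat_pow[OF P, of t]]
  have "tv_dist (unit_vec n i \<^sub>v* (P ^\<^sub>m t)) (stationary_dist P) \<le> c"
    using assms mixing_dist_le_iff by blast
  moreover have "mean (unit_vec n i \<^sub>v* (P ^\<^sub>m t)) (\<lambda>x. 1 - f x) - mean (stationary_dist P) (\<lambda>x. 1 - f x)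
      \<le> tv_dist (unit_vec n i \<^sub>v* (P ^\<^sub>m t)) (stationary_dist P)"
    by (rule tv_dist_ge_mean_diff[OF u \<pi>]) (use assms(5) in auto)
  ultimately show ?thesis
    unfolding mean_compl[OF u \<pi>]
    unfolding mean_unit_vec_mat_pow[OF stochastic_matsD(1)[OF P] assms(4)] by simp
qed

text \<open>The sign is opposite to that of \<open>mixing_dist_le_D\<close>. In contrapositive form
  the rule extracts a start and a test function from a large distance.\<close>

lemma mixing_dist_leI:
  assumes "P \<in> ergodic_mats n" "n \<ge> 1"
    and "\<And>i f. i < n \<Longrightarrow> (\<And>j. 0 \<le> f j \<and> f j \<le> 1) \<Longrightarrow>
      (markov_op P ^^ t) f i - mean (stationary_dist P) f \<le> c"
  shows "mixing_dist P t \<le> c"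
  unfolding mixing_dist_le_iff[OF assms(1,2)]
proof (intro allI impI)
  fix i assume i: "i < n"
  note \<pi> = stationary_dist(1)[OF assms(1,2)]
  have P: "P \<in> stochastic_mats n" using assms(1) by (simp add: ergodic_mats_def)
  note u = prob_vec_mult_mat[OF unit_vec_prob[OF i] stochastic_mat_pow[OF P, of t]]
  obtain f where f: "\<And>j. 0 \<le> f j \<and> f j \<le> 1"
    "tv_dist (unit_vec n i \<^sub>v* (P ^\<^sub>m t)) (stationary_dist P)
      = mean (unit_vec n i \<^sub>v* (P ^\<^sub>m t)) f - mean (stationary_dist P) f"
    using tv_dist_attained[OF u \<pi>] by blast
  then show "tv_dist (unit_vec n i \<^sub>v* (P ^\<^sub>m t)) (stationary_dist P) \<le> c"
    using assms(3)[OF i f(1)] by (simp add: mean_unit_vec_mat_pow[OF stochastic_matsD(1)[OF P] i])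
qed

text \<open>By laziness an entry that is positive at one time stays positive later, so any common
  upper bound of the times \<open>T i j\<close> works; their sum is one.\<close>

lemma ex_positive_power:
  assumes P: "P \<in> stochastic_mats n" and irr: "irreducible_chain P" and lz: "lazy_chain P"
  obtains N where "\<And>i j. i < n \<Longrightarrow> j < n \<Longrightarrow> 0 < (P ^\<^sub>m N) $$ (i, j)"
proof -
  note PD = stochastic_matsD[OF P]
  have Suc: "0 < (P ^\<^sub>m Suc t) $$ (i, j)" if "i < n" "j < n" "0 < (P ^\<^sub>m t) $$ (i, j)" for i j t
  proof -
    note Q = stochastic_matsD[OF stochastic_mat_pow[OF P, of t]]
    have "0 < (P ^\<^sub>m t) $$ (i, j) * P $$ (j, j)"
      using that lz PD(2) by (fastforce simp: lazy_chain_def)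
    also have "\<dots> \<le> (\<Sum>k<n. (P ^\<^sub>m t) $$ (i, k) * P $$ (k, j))"
      using that Q PD by (intro member_le_sum[where f = "\<lambda>k. (P ^\<^sub>m t) $$ (i, k) * P $$ (k, j)"]) auto
    also have "\<dots> = (P ^\<^sub>m Suc t) $$ (i, j)"
      using that PD(1) Q(1) by (simp add: scalar_prod_def atLeast0LessThan)
    finally show ?thesis .
  qed
  have "\<exists>T. \<forall>i<n. \<forall>j<n. 0 < (P ^\<^sub>m T i j) $$ (i, j)"
    using irr PD(2) unfolding irreducible_chain_def by metis
  then obtain T where T: "\<And>i j. i < n \<Longrightarrow> j < n \<Longrightarrow> 0 < (P ^\<^sub>m T i j) $$ (i, j)" by blast
  define N where "N = (\<Sum>i<n. \<Sum>j<n. T i j)"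
  show ?thesis
  proof (rule that[of N])
    fix i j assume ij: "i < n" "j < n"
    have "T i j \<le> (\<Sum>j<n. T i j)" using ij by (intro member_le_sum) auto
    also have "\<dots> \<le> N" unfolding N_def
      using ij by (intro member_le_sum[where f = "\<lambda>i. \<Sum>j<n. T i j"]) auto
    finally show "0 < (P ^\<^sub>m N) $$ (i, j)"
      by (induction rule: dec_induct) (use T Suc ij in auto)
  qed
qed

text \<open>Removing c from every entry leaves nonnegative rows of sum 1 - n c. The removed part
  contributes the same amount in each row, so the oscillation of g shrinks by the factor 1 - n
  c.\<close>

lemma doeblin_contraction:
  assumes Q: "Q \<in> stochastic_mats n" and c: "\<And>i j. i < n \<Longrightarrow> j < n \<Longrightarrow> c \<le> Q $$ (i, j)"
    and g: "\<And>j. j < n \<Longrightarrow> m \<le> g j \<and> g j \<le> m + r" and i: "i < n"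
  shows "m + c * (\<Sum>j<n. g j - m) \<le> markov_op Q g i"
    "markov_op Q g i \<le> m + c * (\<Sum>j<n. g j - m) + (1 - real n * c) * r"
proof -
  note QD = stochastic_matsD[OF Q]
  have eq: "markov_op Q g i = m + c * (\<Sum>j<n. g j - m) + (\<Sum>j<n. (Q $$ (i, j) - c) * (g j - m))"
  proof -
    have "(\<Sum>j<n. (Q $$ (i, j) - c) * (g j - m)) =
        (\<Sum>j<n. Q $$ (i, j) * g j - Q $$ (i, j) * m - c * (g j - m))"
      by (intro sum.cong) (auto simp: algebra_simps)
    also have "\<dots> = markov_op Q g i - m - c * (\<Sum>j<n. g j - m)"
      using QD(5)[OF i]
      by (simp add: sum_subtractf markov_op_def QD(3) flip: sum_distrib_left sum_distrib_right)
    finally show ?thesis by simp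
  qed
  have "0 \<le> (\<Sum>j<n. (Q $$ (i, j) - c) * (g j - m))"
    using c i g by (intro sum_nonneg mult_nonneg_nonneg) auto
  then show "m + c * (\<Sum>j<n. g j - m) \<le> markov_op Q g i" using eq by simp
  have "(\<Sum>j<n. (Q $$ (i, j) - c) * (g j - m)) \<le> (\<Sum>j<n. (Q $$ (i, j) - c) * r)"
  proof (intro sum_mono mult_left_mono)
    fix j assume "j \<in> {..<n}"
    then show "g j - m \<le> r" "0 \<le> Q $$ (i, j) - c" using g[of j] c[OF i, of j] by auto
  qed
  also have "\<dots> = (1 - real n * c) * r"
    using QD(5)[OF i] by (simp add: sum_subtractf flip: sum_distrib_right)
  finally show "markov_op Q g i \<le> m + c * (\<Sum>j<n. g j - m) + (1 - real n * c) * r"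
    using eq by simp
qed

text \<open>This is the convergence theorem; it guarantees that the \<open>LEAST\<close> in
  \<open>t_mix\<close> is attained.\<close>

lemma ex_mixing_dist_le:
  assumes P: "P \<in> ergodic_mats n" and n: "n \<ge> 1" and lz: "lazy_chain P" and \<epsilon>: "0 < \<epsilon>"
  shows "\<exists>t. mixing_dist P t \<le> \<epsilon>"
proof -
  have Ps: "P \<in> stochastic_mats n" and irr: "irreducible_chain P"
    using P by (auto simp: ergodic_mats_def)
  note \<pi> = stationary_dist[OF P n]
  obtain N where N: "\<And>i j. i < n \<Longrightarrow> j < n \<Longrightarrow> 0 < (P ^\<^sub>m N) $$ (i, j)"
    using ex_positive_power[OF Ps irr lz] by blast
  let ?Q = "P ^\<^sub>m N"
  have Q: "?Q \<in> stochastic_mats n" by (rule stochastic_mat_pow[OF Ps])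
  define c where "c = Min ((\<lambda>(i, j). ?Q $$ (i, j)) ` ({..<n} \<times> {..<n}))"
  have c: "c \<le> ?Q $$ (i, j)" if "i < n" "j < n" for i j
    unfolding c_def using that by (intro Min_le) (auto intro!: image_eqI[where x = "(i, j)"])
  have c0: "c > 0"
    unfolding c_def using n N by (subst Min_gr_iff) (auto simp: lessThan_empty_iff)
  have cn: "real n * c \<le> 1"
    using sum_mono[of "{..<n}" "\<lambda>_. c" "\<lambda>j. ?Q $$ (0, j)"] c[of 0] n stochastic_matsD(5)[OF Q, of 0] by simp
  let ?r = "1 - real n * c"
  \<comment> \<open>The interval may move with f and k, but its length does not depend on f, so one
    k serves all test functions. By invariance the stationary mean of f lies in the same
    interval.\<close>
  have osc: "\<exists>m. \<forall>i<n. m \<le> (markov_op P ^^ (N * k)) f i \<and> (markov_op P ^^ (N * k)) f i \<le> m + ?r ^ k"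
    if f: "\<And>j. 0 \<le> f j \<and> f j \<le> 1" for k and f :: "nat \<Rightarrow> real"
  proof (induction k)
    case 0
    show ?case using f by (intro exI[of _ 0]) simp
  next
    case (Suc k)
    then obtain m where m: "\<And>i. i < n \<Longrightarrow> m \<le> (markov_op P ^^ (N * k)) f i \<and>
      (markov_op P ^^ (N * k)) f i \<le> m + ?r ^ k" by blast
    let ?g = "(markov_op P ^^ (N * k)) f"
    have "(markov_op P ^^ (N * Suc k)) f i = markov_op ?Q ?g i" if "i < n" for i
      by (simp add: funpow_add markov_op_mat_pow[OF stochastic_matsD(1)[OF Ps] that])
    then show ?case
      using doeblin_contraction[OF Q c m]
      by (intro exI[of _ "m + c * (\<Sum>j<n. ?g j - m)"]) simp
  qed
  have "?r < 1" "0 \<le> ?r" using c0 cn n by auto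
  then obtain k where k: "?r ^ k < \<epsilon>" using real_arch_pow_inv[OF \<epsilon>] by blast
  have "mixing_dist P (N * k) \<le> \<epsilon>"
  proof (rule mixing_dist_leI[OF P n])
    fix i and f :: "nat \<Rightarrow> real"
    assume i: "i < n" and f: "\<And>j. 0 \<le> f j \<and> f j \<le> 1"
    obtain m where m: "\<And>i. i < n \<Longrightarrow> m \<le> (markov_op P ^^ (N * k)) f i \<and>
      (markov_op P ^^ (N * k)) f i \<le> m + ?r ^ k" using osc[of f k, OF f] by blast
    have "m \<le> mean (stationary_dist P) ((markov_op P ^^ (N * k)) f)"
      using mean_mono[OF \<pi>(1), of "\<lambda>_. m"] m by (simp add: mean_const[OF \<pi>(1)])
    then show "(markov_op P ^^ (N * k)) f i - mean (stationary_dist P) f \<le> \<epsilon>"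
      using m[OF i] k by (simp add: mean_stationary_pow[OF \<pi>(1) Ps \<pi>(2)])
  qed
  then show ?thesis ..
qed

lemma mixing_dist_t_mix:
  assumes "P \<in> ergodic_mats n" "n \<ge> 1" "lazy_chain P" "0 < \<epsilon>"
  shows "mixing_dist P (t_mix P \<epsilon>) \<le> \<epsilon>"
  unfolding t_mix_def using ex_mixing_dist_le[OF assms] by (rule LeastI_ex)

lemma t_mix_antimono:
  assumes "P \<in> ergodic_mats n" "n \<ge> 1" "lazy_chain P" "0 < \<delta>" "\<delta> \<le> \<epsilon>"
  shows "t_mix P \<epsilon> \<le> t_mix P \<delta>"
  using mixing_dist_t_mix[OF assms(1-4)] assms(5)
  unfolding t_mix_def[of P \<epsilon>] by (intro Least_le) simp

text \<open>If the chain were mixed at time 0, testing with the complement of a state i would give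
  \<pi>(i) >= \<epsilon> for each i, and the total mass 1 would be at least n \<epsilon>. The bound
  keeps zero denominators out of the asymptotic arguments.\<close>

lemma t_mix_pos:
  assumes P: "P \<in> ergodic_mats n" and n: "n \<ge> 1" and lz: "lazy_chain P"
    and \<epsilon>: "\<epsilon> < 1" and large: "1 / real n < \<epsilon>"
  shows "0 < t_mix P (1 - \<epsilon>)"
proof (rule ccontr)
  assume "\<not> 0 < t_mix P (1 - \<epsilon>)"
  then have d: "mixing_dist P 0 \<le> 1 - \<epsilon>"
    using mixing_dist_t_mix[OF P n lz, of "1 - \<epsilon>"] \<epsilon> by simp
  note \<pi> = prob_vecsD[OF stationary_dist(1)[OF P n]]
  have "\<epsilon> \<le> stationary_dist P $ i" if i: "i < n" for i
  proof -
    have "mean (stationary_dist P) (\<lambda>j. if j = i then 0 else 1) =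
        (\<Sum>j<n. stationary_dist P $ j - (if j = i then stationary_dist P $ j else 0))"
      unfolding mean_def \<pi>(2) by (intro sum.cong) auto
    also have "\<dots> = 1 - stationary_dist P $ i"
      using i \<pi>(4) by (simp add: sum_subtractf)
    finally show ?thesis
      using mixing_dist_le_D[OF P n d i, of "\<lambda>j. if j = i then 0 else 1"] by simp
  qed
  then have "(\<Sum>i<n. \<epsilon>) \<le> (\<Sum>i<n. stationary_dist P $ i)" by (intro sum_mono) auto
  then have "real n * \<epsilon> \<le> 1" using \<pi>(4) by simp
  then show False using large n by (simp add: field_simps)
qed

subsection \<open>A maximal inequality for reversible chains\<close>

lemma mean_markov_op_self_adjoint:
  assumes P: "P \<in> stochastic_mats n" and p: "p \<in> prob_vecs n"
    and rev: "\<forall>i<n. \<forall>j<n. p $ i * P $$ (i, j) = p $ j * P $$ (j, i)"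
  shows "mean p (\<lambda>x. f x * markov_op P g x) = mean p (\<lambda>x. markov_op P f x * g x)"
proof -
  note d = prob_vecsD(2)[OF p] stochastic_matsD(3)[OF P]
  have "mean p (\<lambda>x. f x * markov_op P g x) = (\<Sum>i<n. \<Sum>j<n. p $ i * P $$ (i, j) * (f i * g j))"
    by (simp add: mean_def markov_op_def d sum_distrib_left mult_ac)
  also have "\<dots> = (\<Sum>i<n. \<Sum>j<n. p $ j * P $$ (j, i) * (f i * g j))"
    using rev by (intro sum.cong) auto
  also have "\<dots> = (\<Sum>j<n. \<Sum>i<n. p $ j * P $$ (j, i) * (f i * g j))"
    by (rule sum.swap)
  also have "\<dots> = mean p (\<lambda>x. markov_op P f x * g x)"
    by (simp add: mean_def markov_op_def d sum_distrib_left sum_distrib_right mult_ac)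
  finally show ?thesis .
qed

text \<open>
  In probabilistic terms, \<open>h x\<close> is the probability that the chain \<open>X\<close> started at \<open>x\<close> satisfies
  \<open>P\<^sup>t f (X\<^sub>t) \<ge> \<eta>\<close> for some \<open>t < k\<close>. As \<open>P\<^sup>t f (X\<^sub>t)\<close> is a martingale in reversed time, the middle
  claim is Doob's inequality; it is proved here by following the first step of the chain.
\<close>

lemma hitting_maximal_inequality:
  assumes P: "P \<in> stochastic_mats n" and p: "p \<in> prob_vecs n" and st: "p \<^sub>v* P = p"
    and rev: "\<forall>i<n. \<forall>j<n. p $ i * P $$ (i, j) = p $ j * P $$ (j, i)"
  shows "\<exists>h. (\<forall>x<n. 0 \<le> h x \<and> h x \<le> 1) \<and> \<eta> * mean p h \<le> mean p (\<lambda>x. f x * h x) \<and>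
    (\<forall>t<k. \<forall>x<n. (markov_op P ^^ t) (\<lambda>y. if \<eta> \<le> (markov_op P ^^ t) f y then 1 else 0) x \<le> h x)"
proof (induction k arbitrary: f)
  case 0
  show ?case by (intro exI[of _ "\<lambda>_. 0"]) (simp add: mean_def)
next
  case (Suc k)
  let ?L = "markov_op P"
  obtain h where h: "\<And>x. x < n \<Longrightarrow> 0 \<le> h x \<and> h x \<le> 1"
    "\<eta> * mean p h \<le> mean p (\<lambda>x. ?L f x * h x)"
    "\<And>t x. t < k \<Longrightarrow> x < n \<Longrightarrow>
      (?L ^^ t) (\<lambda>y. if \<eta> \<le> (?L ^^ t) (?L f) y then 1 else 0) x \<le> h x"
    using Suc.IH[of "?L f"] by blast
  have Lh: "0 \<le> ?L h x \<and> ?L h x \<le> 1" if "x < n" for x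
    using markov_op_pow_bounds[OF P, of 0 h 1 x 1] h(1) that by simp
  \<comment> \<open>\<open>?g\<close> is the probability of hitting at time 0 but not later. It
    lives where \<eta> <= f, which gives its share of the estimate; the share of \<open>?L h\<close>
    is the induction hypothesis for \<open>?L f\<close>, moved onto f by self-adjointness.\<close>
  let ?g = "\<lambda>x. if \<eta> \<le> f x then 1 - ?L h x else 0"
  let ?h = "\<lambda>x. if \<eta> \<le> f x then 1 else ?L h x"
  have h_eq: "?h = (\<lambda>x. ?L h x + ?g x)" by auto
  have "\<eta> * mean p ?h = \<eta> * mean p h + mean p (\<lambda>x. \<eta> * ?g x)"
    unfolding h_eq by (simp only: mean_add mean_stationary[OF p P st] mean_cmult distrib_left)
  also have "\<dots> \<le> mean p (\<lambda>x. ?L f x * h x) + mean p (\<lambda>x. f x * ?g x)"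
  proof (rule add_mono[OF h(2) mean_mono[OF p]])
    fix x assume "x < n"
    then show "\<eta> * ?g x \<le> f x * ?g x" using Lh[of x] by (simp add: mult_right_mono)
  qed
  also have "\<dots> = mean p (\<lambda>x. f x * ?L h x + f x * ?g x)"
    unfolding mean_add mean_markov_op_self_adjoint[OF P p rev] ..
  also have "\<dots> = mean p (\<lambda>x. f x * ?h x)"
    by (rule mean_cong[OF prob_vecsD(2)[OF p]]) (simp add: algebra_simps)
  finally have "\<eta> * mean p ?h \<le> mean p (\<lambda>x. f x * ?h x)" .
  moreover have "(?L ^^ t) (\<lambda>y. if \<eta> \<le> (?L ^^ t) f y then 1 else 0) x \<le> ?h x"
    if t: "t < Suc k" and x: "x < n" for t x
  proof (cases t)
    case 0
    then show ?thesis using Lh[OF x] by simp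
  next
    case (Suc s)
    have "(?L ^^ Suc s) (\<lambda>y. if \<eta> \<le> (?L ^^ Suc s) f y then 1 else 0) x =
        ?L ((?L ^^ s) (\<lambda>y. if \<eta> \<le> (?L ^^ s) (?L f) y then 1 else 0)) x"
      by (simp add: funpow_swap1)
    also have "\<dots> \<le> ?L h x"
      using t Suc by (intro markov_op_mono[OF P x] h(3)) auto
    finally show ?thesis using Lh[OF x] Suc by simp
  qed
  ultimately show ?case using Lh by (intro exI[of _ ?h]) auto
qed

text \<open>P^(2t) f is P^t applied to P^t f, and P^t f <= 1 is at most \<eta> plus the indicator of
  P^t f >= \<eta>. Applying P^t to that indicator gives at most the hitting probability h. The bound
  on the mean of h is free of k.\<close>

lemma even_maximal_inequality:
  assumes P: "P \<in> stochastic_mats n" and p: "p \<in> prob_vecs n" and st: "p \<^sub>v* P = p"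
    and rev: "\<forall>i<n. \<forall>j<n. p $ i * P $$ (i, j) = p $ j * P $$ (j, i)"
    and f: "\<forall>x<n. 0 \<le> f x \<and> f x \<le> 1" and \<eta>: "0 < \<eta>"
  obtains h where "\<And>x. x < n \<Longrightarrow> 0 \<le> h x" "mean p h \<le> mean p f / \<eta>"
    "\<And>t x. t < k \<Longrightarrow> x < n \<Longrightarrow> (markov_op P ^^ (2 * t)) f x \<le> \<eta> + h x"
proof -
  let ?L = "markov_op P"
  obtain h where h: "\<And>x. x < n \<Longrightarrow> 0 \<le> h x \<and> h x \<le> 1"
    "\<eta> * mean p h \<le> mean p (\<lambda>x. f x * h x)"
    "\<And>t x. t < k \<Longrightarrow> x < n \<Longrightarrow>
      (?L ^^ t) (\<lambda>y. if \<eta> \<le> (?L ^^ t) f y then 1 else 0) x \<le> h x"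
    using hitting_maximal_inequality[OF P p st rev, of \<eta> f k] by blast
  show ?thesis
  proof (rule that[of h])
    show "0 \<le> h x" if "x < n" for x using h(1)[OF that] by simp
    have "mean p (\<lambda>x. f x * h x) \<le> mean p f"
      using h(1) f mult_left_le by (intro mean_mono[OF p]) blast
    then have "mean p h * \<eta> \<le> mean p f" using h(2) by (simp add: mult.commute)
    then show "mean p h \<le> mean p f / \<eta>" using \<eta> by (simp add: pos_le_divide_eq)
    show "(?L ^^ (2 * t)) f x \<le> \<eta> + h x" if t: "t < k" and x: "x < n" for t x
    proof -
      have "(?L ^^ (2 * t)) f x = (?L ^^ t) ((?L ^^ t) f) x"
        by (simp add: mult_2 funpow_add)
      also have "\<dots> \<le> (?L ^^ t) (\<lambda>y. \<eta> + (if \<eta> \<le> (?L ^^ t) f y then 1 else 0)) x"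
      proof (rule markov_op_pow_mono[OF P _ x])
        fix y assume "y < n"
        then have "(?L ^^ t) f y \<le> 1"
          using f by (intro markov_op_pow_bounds(2)[OF P, of 0]) auto
        then show "(?L ^^ t) f y \<le> \<eta> + (if \<eta> \<le> (?L ^^ t) f y then 1 else 0)"
          using \<eta> by simp
      qed
      also have "\<dots> \<le> \<eta> + h x"
        using h(3)[OF t x]
        by (simp add: markov_op_pow_add[OF stochastic_matsD(3)[OF P] x] markov_op_pow_const[OF P x])
      finally show ?thesis .
    qed
  qed
qed

lemma maximal_inequality:
  assumes P: "P \<in> stochastic_mats n" and p: "p \<in> prob_vecs n" and st: "p \<^sub>v* P = p"
    and rev: "\<forall>i<n. \<forall>j<n. p $ i * P $$ (i, j) = p $ j * P $$ (j, i)"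
    and f: "\<forall>x<n. 0 \<le> f x \<and> f x \<le> 1" and \<eta>: "0 < \<eta>"
  obtains h where "\<And>x. x < n \<Longrightarrow> 0 \<le> h x \<and> h x \<le> 1" "mean p h \<le> \<eta> + 2 * mean p f / \<eta>"
    "\<And>t x. t \<le> k \<Longrightarrow> x < n \<Longrightarrow> (markov_op P ^^ t) f x \<le> h x"
proof -
  let ?L = "markov_op P"
  obtain h where h: "\<And>x. x < n \<Longrightarrow> 0 \<le> h x" "mean p h \<le> mean p f / \<eta>"
    "\<And>t x. t < Suc k \<Longrightarrow> x < n \<Longrightarrow> (?L ^^ (2 * t)) f x \<le> \<eta> + h x"
    using even_maximal_inequality[where k = "Suc k", OF P p st rev f \<eta>] by blast
  have f1: "(?L ^^ t) f x \<le> 1" if "x < n" for t x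
    using f that by (intro markov_op_pow_bounds(2)[OF P, of 0]) auto
  have Lf: "\<forall>x<n. 0 \<le> ?L f x \<and> ?L f x \<le> 1"
    using markov_op_pow_bounds[OF P, of 0 f 1 _ 1] f by simp
  obtain g where g: "\<And>x. x < n \<Longrightarrow> 0 \<le> g x" "mean p g \<le> mean p (?L f) / \<eta>"
    "\<And>t x. t < Suc k \<Longrightarrow> x < n \<Longrightarrow> (?L ^^ (2 * t)) (?L f) x \<le> \<eta> + g x"
    using even_maximal_inequality[where k = "Suc k", OF P p st rev Lf \<eta>] by blast
  \<comment> \<open>h covers even times and g odd times; P f has the same stationary mean as f,
    whence the factor 2. Truncation at 1 makes this a test function and is harmless because the
    iterates of f are at most 1.\<close>
  let ?h = "\<lambda>x. min 1 (\<eta> + (h x + g x))"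
  show ?thesis
  proof (rule that[of ?h])
    show "0 \<le> ?h x \<and> ?h x \<le> 1" if "x < n" for x using h(1) g(1) \<eta> that by simp
    have "mean p ?h \<le> mean p (\<lambda>x. \<eta> + (h x + g x))" by (intro mean_mono[OF p]) simp
    also have "\<dots> \<le> \<eta> + 2 * mean p f / \<eta>"
      using h(2) g(2) by (simp add: mean_add mean_const[OF p] mean_stationary[OF p P st])
    finally show "mean p ?h \<le> \<eta> + 2 * mean p f / \<eta>" .
    show "(?L ^^ t) f x \<le> ?h x" if t: "t \<le> k" and x: "x < n" for t x
    proof (cases "even t")
      case True
      then obtain s where "t = 2 * s" by blast
      then show ?thesis
        using h(3)[of s x] g(1)[OF x] t x f1[OF x, of t] by simp
    next
      case False
      then obtain s where "t = Suc (2 * s)" by (auto elim: oddE)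
      then have "(?L ^^ t) f x = (?L ^^ (2 * s)) (?L f) x" "s < Suc k"
        using t by (auto simp: funpow_swap1)
      then show ?thesis
        using g(3)[of s x] h(1)[OF x] x f1[OF x, of t] by simp
    qed
  qed
qed

subsection \<open>Bounds for the restarted chain\<close>

text \<open>The ages u < m have weights \<alpha> (1 - \<alpha>)^u with sum 1 - (1 - \<alpha>)^m; the
  remaining term is nonnegative and dropped.\<close>

lemma restart_mean_ge_start:
  assumes P: "P \<in> stochastic_mats n" and n: "n \<ge> 1" and s: "\<sigma> \<in> prob_vecs n"
    and a: "\<alpha> \<in> {0<..<1}" and g: "\<And>x. x < n \<Longrightarrow> 0 \<le> g x"
    and c: "\<And>u. u < m \<Longrightarrow> c \<le> mean \<sigma> ((markov_op P ^^ u) g)"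
  shows "c * (1 - (1 - \<alpha>) ^ m) \<le> mean (stationary_dist (restart_mat \<alpha> \<sigma> P)) g"
  using g c
proof (induction m arbitrary: g)
  case 0
  then show ?case using mean_nonneg[OF restart_stationary(1)[OF P n s a]] by simp
next
  case (Suc m)
  let ?p = "stationary_dist (restart_mat \<alpha> \<sigma> P)"
  have "c * (1 - (1 - \<alpha>) ^ m) \<le> mean ?p (markov_op P g)"
  proof (rule Suc.IH)
    show "0 \<le> markov_op P g x" if "x < n" for x
      using markov_op_mono[OF P that, of "\<lambda>_. 0" g] Suc.prems(1) by (simp add: markov_op_const[OF P that])
    show "c \<le> mean \<sigma> ((markov_op P ^^ u) (markov_op P g))" if "u < m" for u
      using Suc.prems(2)[of "Suc u"] that by (simp add: funpow_swap1)
  qed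
  then have "(1 - \<alpha>) * (c * (1 - (1 - \<alpha>) ^ m)) + \<alpha> * c
      \<le> (1 - \<alpha>) * mean ?p (markov_op P g) + \<alpha> * mean \<sigma> g"
    using a Suc.prems(2)[of 0] by (intro add_mono mult_left_mono) auto
  then show ?case
    unfolding restart_stationary(2)[OF P n s a, of g] by (simp add: algebra_simps)
qed

text \<open>The complementary half of the expansion: only the term without restarts in the last m
  steps is kept.\<close>

lemma restart_mean_ge_pow:
  assumes P: "P \<in> stochastic_mats n" and n: "n \<ge> 1" and s: "\<sigma> \<in> prob_vecs n"
    and a: "\<alpha> \<in> {0<..<1}" and g: "\<And>x. x < n \<Longrightarrow> 0 \<le> g x"
  defines "p \<equiv> stationary_dist (restart_mat \<alpha> \<sigma> P)"
  shows "(1 - \<alpha>) ^ m * mean p ((markov_op P ^^ m) g) \<le> mean p g"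
  using g
proof (induction m arbitrary: g)
  case (Suc m)
  have "(1 - \<alpha>) ^ m * mean p ((markov_op P ^^ m) (markov_op P g)) \<le> mean p (markov_op P g)"
  proof (rule Suc.IH)
    show "0 \<le> markov_op P g x" if "x < n" for x
      using markov_op_mono[OF P that, of "\<lambda>_. 0" g] Suc.prems by (simp add: markov_op_const[OF P that])
  qed
  then have "(1 - \<alpha>) * ((1 - \<alpha>) ^ m * mean p ((markov_op P ^^ m) (markov_op P g)))
      \<le> (1 - \<alpha>) * mean p (markov_op P g)"
    using a by (intro mult_left_mono) auto
  also have "\<dots> \<le> mean p g"
    using restart_stationary(2)[OF P n s a, of g] mean_nonneg[OF s Suc.prems] a
    by (simp add: p_def)
  finally show ?case by (simp add: funpow_swap1 mult.assoc)
qed simp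

lemma restart_tv_le:
  assumes P: "P \<in> ergodic_mats n" and n: "n \<ge> 1" and s: "\<sigma> \<in> prob_vecs n"
    and a: "\<alpha> \<in> {0<..<1}" and d: "mixing_dist P t \<le> c" and c: "c \<le> 1"
  shows "tv_dist (stationary_dist P) (stationary_dist (restart_mat \<alpha> \<sigma> P)) \<le> 1 - (1 - \<alpha>) ^ t * (1 - c)"
proof -
  let ?\<pi> = "stationary_dist P" and ?p = "stationary_dist (restart_mat \<alpha> \<sigma> P)"
  have Ps: "P \<in> stochastic_mats n" using P by (simp add: ergodic_mats_def)
  note \<pi> = stationary_dist(1)[OF P n] and p = restart_stationary(1)[OF Ps n s a]
  obtain f where f: "\<And>i. 0 \<le> f i \<and> f i \<le> 1" "tv_dist ?\<pi> ?p = mean ?\<pi> f - mean ?p f"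
    using tv_dist_attained[OF \<pi> p] by blast
  let ?b = "(1 - \<alpha>) ^ t"
  have b: "0 \<le> ?b" "?b \<le> 1" using a by (auto intro: power_le_one)
  have "mean ?\<pi> f - c \<le> mean ?p ((markov_op P ^^ t) f)"
    using mean_mono[OF p, of "\<lambda>_. mean ?\<pi> f - c"] mixing_dist_le_D[OF P n d, of _ f] f(1)
    by (force simp: mean_const[OF p] algebra_simps)
  then have "?b * (mean ?\<pi> f - c) \<le> mean ?p f"
    using restart_mean_ge_pow[OF Ps n s a, of f t] f(1) b(1) mult_left_mono order_trans by meson
  \<comment> \<open>On the remaining weight 1 - b nothing is known about the restarted law, so
    \<pi>(f) <= 1 is all that is used there.\<close>
  moreover have "(1 - ?b) * mean ?\<pi> f \<le> 1 - ?b"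
    using mean_mono[OF \<pi>, of f "\<lambda>_. 1"] f(1) b by (simp add: mean_const[OF \<pi>] mult_left_le)
  ultimately show ?thesis unfolding f(2) by (simp add: algebra_simps)
qed

lemma restart_tv_ge:
  assumes P: "P \<in> ergodic_mats n" and n: "n \<ge> 1" and rev: "reversible_chain P"
    and a: "\<alpha> \<in> {0<..<1}" and \<delta>: "0 < \<delta>" "\<delta> < 1" and d: "1 - \<delta> < mixing_dist P t"
  shows "\<exists>i<n. (1 - \<delta>) * (1 - (1 - \<alpha>) ^ Suc t) - 3 * sqrt \<delta>
    \<le> tv_dist (stationary_dist P) (stationary_dist (restart_mat \<alpha> (unit_vec n i) P))"
proof -
  let ?\<pi> = "stationary_dist P" and ?L = "markov_op P"
  have Ps: "P \<in> stochastic_mats n" using P by (simp add: ergodic_mats_def)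
  note \<pi> = stationary_dist[OF P n]
  have rev: "\<forall>i<n. \<forall>j<n. ?\<pi> $ i * P $$ (i, j) = ?\<pi> $ j * P $$ (j, i)"
    using rev stochastic_matsD(2)[OF Ps] by (simp add: reversible_chain_def)
  obtain i f where i: "i < n" and f: "\<And>j. 0 \<le> f j \<and> f j \<le> 1"
    and gt: "1 - \<delta> < (?L ^^ t) f i - mean ?\<pi> f"
    using mixing_dist_leI[OF P n, of t "1 - \<delta>"] d by (meson not_le)
  \<comment> \<open>A gap above 1 - \<delta> between two numbers in [0,1] pushes one above 1 -
    \<delta> and the other below \<delta>.\<close>
  have "(?L ^^ t) f i \<le> 1"
    using f i by (intro markov_op_pow_bounds(2)[OF Ps, of 0]) auto
  with gt have small: "mean ?\<pi> f \<le> \<delta>" by simp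
  have big: "1 - \<delta> \<le> (?L ^^ t) f i" using gt mean_nonneg[OF \<pi>(1), of f] f by simp
  \<comment> \<open>With \<pi>(f) <= \<delta>, the threshold \<eta> = sqrt \<delta> brings both
    terms of \<eta> + 2 \<pi>(f) / \<eta> to order sqrt \<delta>, for a total of 3 sqrt
    \<delta>.\<close>
  obtain h where h: "\<And>x. x < n \<Longrightarrow> 0 \<le> h x \<and> h x \<le> 1"
    "mean ?\<pi> h \<le> sqrt \<delta> + 2 * mean ?\<pi> f / sqrt \<delta>"
    "\<And>u x. u \<le> t \<Longrightarrow> x < n \<Longrightarrow> (?L ^^ u) f x \<le> h x"
    using maximal_inequality[OF Ps \<pi> rev, of f "sqrt \<delta>" t] f \<delta>(1) by (metis real_sqrt_gt_0_iff)
  have "2 * mean ?\<pi> f / sqrt \<delta> \<le> 2 * \<delta> / sqrt \<delta>"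
    using small \<delta> by (intro divide_right_mono) auto
  also have "\<dots> = 2 * sqrt \<delta>"
    using \<delta>(1) by (simp add: real_div_sqrt flip: times_divide_eq_right)
  finally have hs: "mean ?\<pi> h \<le> 3 * sqrt \<delta>" using h(2) by simp
  let ?\<sigma> = "unit_vec n i"
  let ?p = "stationary_dist (restart_mat \<alpha> ?\<sigma> P)"
  note s = unit_vec_prob[OF i]
  note p = restart_stationary(1)[OF Ps n s a]
  have "(1 - \<delta>) * (1 - (1 - \<alpha>) ^ Suc t) \<le> mean ?p h"
  proof (rule restart_mean_ge_start[OF Ps n s a])
    show "0 \<le> h x" if "x < n" for x using h(1)[OF that] by simp
    fix u assume u: "u < Suc t"
    \<comment> \<open>Run the chain for u steps and let h dominate the remaining t - u steps. Ages 0
      to t all qualify, hence the exponent \<open>Suc t\<close>.\<close>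
    have "1 - \<delta> \<le> (?L ^^ (u + (t - u))) f i" using big u by simp
    also have "\<dots> = (?L ^^ u) ((?L ^^ (t - u)) f) i" unfolding funpow_add comp_apply ..
    also have "\<dots> \<le> (?L ^^ u) h i"
      by (intro markov_op_pow_mono[OF Ps _ i] h(3)) auto
    finally show "1 - \<delta> \<le> mean ?\<sigma> ((?L ^^ u) h)" by (simp add: mean_unit_vec[OF i])
  qed
  moreover have "mean ?p h - mean ?\<pi> h \<le> tv_dist ?\<pi> ?p"
    using tv_dist_ge_mean_diff[OF \<pi>(1) p, of "\<lambda>x. 1 - h x"] h(1) by (simp add: mean_compl[OF \<pi>(1) p])
  ultimately show ?thesis using hs i by (intro exI[of _ i]) simp
qed

text \<open>The point mass maximizing the distance serves all \<open>\<delta>\<close> and \<open>t\<close> at once.\<close>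

lemma ex_best_restart:
  assumes P: "P \<in> ergodic_mats n" and n: "n \<ge> 1" and rev: "reversible_chain P" and a: "\<alpha> \<in> {0<..<1}"
  shows "\<exists>\<sigma>\<in>prob_vecs n. \<forall>\<delta> t. 0 < \<delta> \<longrightarrow> \<delta> < 1 \<longrightarrow> 1 - \<delta> < mixing_dist P t \<longrightarrow>
    (1 - \<delta>) * (1 - (1 - \<alpha>) ^ Suc t) - 3 * sqrt \<delta>
    \<le> tv_dist (stationary_dist P) (stationary_dist (restart_mat \<alpha> \<sigma> P))"
proof -
  let ?F = "\<lambda>i. tv_dist (stationary_dist P) (stationary_dist (restart_mat \<alpha> (unit_vec n i) P))"
  have "Max (?F ` {..<n}) \<in> ?F ` {..<n}" using n by (intro Max_in) (auto simp: lessThan_empty_iff)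
  then obtain i where i: "i < n" "?F i = Max (?F ` {..<n})" by auto
  have best: "?F j \<le> ?F i" if "j < n" for j unfolding i(2) using that by (intro Max_ge) auto
  show ?thesis
  proof (intro bexI[of _ "unit_vec n i"] allI impI)
    fix \<delta> :: real and t assume "0 < \<delta>" "\<delta> < 1" "1 - \<delta> < mixing_dist P t"
    from restart_tv_ge[OF P n rev a this] obtain j where
      "j < n" "(1 - \<delta>) * (1 - (1 - \<alpha>) ^ Suc t) - 3 * sqrt \<delta> \<le> ?F j" by blast
    then show "(1 - \<delta>) * (1 - (1 - \<alpha>) ^ Suc t) - 3 * sqrt \<delta> \<le> ?F i"
      using best[of j] by linarith
  qed (rule unit_vec_prob[OF i(1)])
qed

subsection \<open>Pre-cutoff and restart sensitivity\<close>

lemma pre_cutoffD: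
  fixes P :: "nat \<Rightarrow> real mat"
  assumes P: "\<And>n. n \<ge> 1 \<Longrightarrow> P n \<in> ergodic_mats n" and lz: "\<And>n. n \<ge> 1 \<Longrightarrow> lazy_chain (P n)"
    and pc: "pre_cutoff P"
  obtains C where "0 < C" "\<And>\<epsilon>. \<epsilon> \<in> {0<..<1/2} \<Longrightarrow>
    \<forall>\<^sub>F n in sequentially. real (t_mix (P n) \<epsilon>) \<le> C * real (t_mix (P n) (1 - \<epsilon>))"
proof -
  let ?q = "\<lambda>\<epsilon> n. real (t_mix (P n) \<epsilon>) / real (t_mix (P n) (1 - \<epsilon>))"
  have "(SUP \<epsilon>\<in>{0<..<1/2}. limsup (\<lambda>n. ereal (?q \<epsilon> n))) \<noteq> \<infinity>"
    using pc unfolding pre_cutoff_def by (rule less_imp_neq)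
  then obtain N where N: "(SUP \<epsilon>\<in>{0<..<1/2}. limsup (\<lambda>n. ereal (?q \<epsilon> n))) < ereal (real N)"
    unfolding less_PInf_Ex_of_nat by blast
  show ?thesis
  \<comment> \<open>The successor makes the constant positive even when N = 0.\<close>
  proof (rule that[of "real (Suc N)"])
    fix \<epsilon> :: real assume \<epsilon>: "\<epsilon> \<in> {0<..<1/2}"
    have "limsup (\<lambda>n. ereal (?q \<epsilon> n)) < ereal (real N)"
      using N by (rule le_less_trans[OF SUP_upper[OF \<epsilon>]])
    then have "\<forall>\<^sub>F n in sequentially. ereal (?q \<epsilon> n) < ereal (real N)" by (rule Limsup_lessD)
    \<comment> \<open>For such n the denominator is positive; otherwise x / 0 = 0 would make a bound
      on the quotient say nothing about the numerator.\<close>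
    moreover have "\<forall>\<^sub>F n in sequentially. 1 / real n < \<epsilon>"
      using order_tendstoD(2)[OF lim_1_over_n[where 'a = real], of \<epsilon>] \<epsilon> by simp
    ultimately show "\<forall>\<^sub>F n in sequentially.
        real (t_mix (P n) \<epsilon>) \<le> real (Suc N) * real (t_mix (P n) (1 - \<epsilon>))"
      using eventually_ge_at_top[of 1]
    proof eventually_elim
      case (elim n)
      have "0 < t_mix (P n) (1 - \<epsilon>)"
        by (rule t_mix_pos[OF P[OF elim(3)] elim(3) lz[OF elim(3)] _ elim(2)]) (use \<epsilon> in auto)
      moreover have "?q \<epsilon> n \<le> real (Suc N)" using elim(1) by simp
      ultimately show ?case by (simp add: pos_divide_le_eq)
    qed
  qed simp
qed

text \<open>
  Monotonicity of \<open>\<epsilon> \<mapsto> \<alpha>\<^sub>\<epsilon>\<close> handles \<open>\<epsilon> \<le> \<epsilon>'\<close> and monotonicity of \<open>\<epsilon> \<mapsto> \<alpha>\<^sub>\<epsilon> t(1 - \<epsilon>)\<close> handles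
  \<open>\<epsilon> \<ge> \<epsilon>'\<close>, where \<open>\<epsilon>'\<close> is a parameter at which \<open>\<alpha>\<^sub>\<epsilon> t(\<epsilon>)\<close> is large.
\<close>

lemma coinciding_restart_fast:
  fixes P :: "nat \<Rightarrow> real mat"
  assumes P: "\<And>n. n \<ge> 1 \<Longrightarrow> P n \<in> ergodic_mats n" and lz: "\<And>n. n \<ge> 1 \<Longrightarrow> lazy_chain (P n)"
    and pc: "pre_cutoff P" and co: "coincides_with_mixing_times P \<alpha>"
    and \<alpha>: "\<And>n \<epsilon>. n \<ge> 1 \<Longrightarrow> \<epsilon> \<in> {0<..<1/2} \<Longrightarrow> \<alpha> n \<epsilon> \<in> {0<..<1}"
    and \<epsilon>: "\<epsilon> \<in> {0<..<1/2}" and \<delta>: "\<delta> \<in> {0<..<1/2}"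
  shows "\<forall>\<^sub>F n in sequentially. K \<le> \<alpha> n \<epsilon> * real (t_mix (P n) (1 - \<delta>))"
proof -
  obtain C where C: "0 < C" "\<And>\<epsilon>. \<epsilon> \<in> {0<..<1/2} \<Longrightarrow>
    \<forall>\<^sub>F n in sequentially. real (t_mix (P n) \<epsilon>) \<le> C * real (t_mix (P n) (1 - \<epsilon>))"
    using pre_cutoffD[OF P lz pc] by blast
  have sup: "(SUP \<epsilon>\<in>{0<..<1/2}. liminf (\<lambda>n. ereal (\<alpha> n \<epsilon> * real (t_mix (P n) \<epsilon>)))) = \<infinity>"
    using co by (simp add: coincides_with_mixing_times_def)
  \<comment> \<open>One factor C pays for reaching t(1 - \<epsilon>) from the parameter e, the other
    for passing from t(\<delta>) to t(1 - \<delta>).\<close>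
  have "ereal (C * (C * K)) < (SUP \<epsilon>\<in>{0<..<1/2}. liminf (\<lambda>n. ereal (\<alpha> n \<epsilon> * real (t_mix (P n) \<epsilon>))))"
    unfolding sup by simp
  then obtain e where e: "e \<in> {0<..<1/2}"
    "ereal (C * (C * K)) < liminf (\<lambda>n. ereal (\<alpha> n e * real (t_mix (P n) e)))"
    unfolding less_SUP_iff by blast
  from less_LiminfD[OF e(2)]
  have "\<forall>\<^sub>F n in sequentially. C * (C * K) < \<alpha> n e * real (t_mix (P n) e)" by simp
  then show ?thesis
    using C(2)[OF e(1)] C(2)[OF \<epsilon>] C(2)[OF \<delta>] eventually_ge_at_top[of 1]
  proof eventually_elim
    case (elim n)
    let ?t = "\<lambda>x. real (t_mix (P n) x)"
    note n = elim(5)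
    have mono: "?t y \<le> ?t x" if "0 < x" "x \<le> y" for x y
      using t_mix_antimono[OF P[OF n] n lz[OF n] that] by simp
    note a = \<alpha>[OF n \<epsilon>] and a' = \<alpha>[OF n e(1)]
    have "C * (C * K) \<le> C * (\<alpha> n \<epsilon> * ?t (1 - \<epsilon>))"
    proof (cases "\<epsilon> \<le> e")
      case True
      then have "\<alpha> n e / \<alpha> n \<epsilon> \<le> 1"
        using co \<epsilon> e(1) n by (auto simp: coincides_with_mixing_times_def)
      then have "\<alpha> n e \<le> \<alpha> n \<epsilon>" using a by (simp add: pos_divide_le_eq)
      then have "\<alpha> n e * ?t e \<le> \<alpha> n \<epsilon> * ?t \<epsilon>"
        using a a' mono[of \<epsilon> e] True \<epsilon> by (intro mult_mono) auto
      also have "\<dots> \<le> \<alpha> n \<epsilon> * (C * ?t (1 - \<epsilon>))"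
        using a elim(3) by (intro mult_left_mono) auto
      finally show ?thesis using elim(1) by (simp add: mult_ac)
    next
      case False
      then have r: "?t (1 - e) / ?t (1 - \<epsilon>) \<le> \<alpha> n \<epsilon> / \<alpha> n e"
        using co \<epsilon> e(1) n by (auto simp: coincides_with_mixing_times_def)
      have "\<alpha> n e * ?t (1 - e) \<le> \<alpha> n \<epsilon> * ?t (1 - \<epsilon>)"
      \<comment> \<open>With a zero denominator the quotient bound is void, but then t(1 - e) <= t(1
        - \<epsilon>) vanishes as well.\<close>
      proof (cases "?t (1 - \<epsilon>) = 0")
        case True
        then show ?thesis using mono[of "1 - \<epsilon>" "1 - e"] False \<epsilon> by simp
      next
        case False
        then show ?thesis using r a' by (simp add: divide_simps mult_ac split: if_splits)
      qed
      moreover have "\<alpha> n e * ?t e \<le> \<alpha> n e * (C * ?t (1 - e))"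
        using a' elim(2) by (intro mult_left_mono) auto
      ultimately have "\<alpha> n e * ?t e \<le> C * (\<alpha> n \<epsilon> * ?t (1 - \<epsilon>))"
        using C(1) by (smt (verit) mult.left_commute mult_left_mono)
      then show ?thesis using elim(1) by simp
    qed
    then have "C * K \<le> \<alpha> n \<epsilon> * ?t (1 - \<epsilon>)" using C(1) by simp
    \<comment> \<open>Any two parameters are linked across 1/2: \<delta> < 1/2 < 1 -
      \<epsilon>.\<close>
    also have "\<dots> \<le> \<alpha> n \<epsilon> * ?t \<delta>"
      using a mono[of \<delta> "1 - \<epsilon>"] \<epsilon> \<delta> by (intro mult_left_mono) auto
    also have "\<dots> \<le> \<alpha> n \<epsilon> * (C * ?t (1 - \<delta>))"
      using a elim(4) by (intro mult_left_mono) auto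
    finally have "C * K \<le> C * (\<alpha> n \<epsilon> * ?t (1 - \<delta>))" by (simp add: mult_ac)
    then show ?case using C(1) by simp
  qed
qed

text \<open>The restart distributions are fixed before the target error e, and \<delta> is chosen
  from e afterwards; this is possible because one \<sigma> satisfies the lower bound for all
  \<delta> and t.\<close>

lemma pre_cutoff_imp_restart_sensitive:
  fixes P :: "nat \<Rightarrow> real mat"
  assumes P: "\<And>n. n \<ge> 1 \<Longrightarrow> P n \<in> ergodic_mats n" and lz: "\<And>n. n \<ge> 1 \<Longrightarrow> lazy_chain (P n)"
    and rev: "\<And>n. n \<ge> 1 \<Longrightarrow> reversible_chain (P n)" and pc: "pre_cutoff P"
  shows "restart_sensitive P"
  unfolding restart_sensitive_def
proof (intro allI impI, elim conjE)
  fix \<alpha> :: "nat \<Rightarrow> real \<Rightarrow> real"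
  assume "\<forall>n\<ge>1. \<forall>\<epsilon>\<in>{0<..<1/2}. \<alpha> n \<epsilon> \<in> {0<..<1}" and co: "coincides_with_mixing_times P \<alpha>"
  then have \<alpha>: "\<alpha> n \<epsilon> \<in> {0<..<1}" if "n \<ge> 1" "\<epsilon> \<in> {0<..<1/2}" for n \<epsilon> using that by blast
  let ?d = "\<lambda>n \<epsilon> s. tv_dist (stationary_dist (P n)) (stationary_dist (restart_mat (\<alpha> n \<epsilon>) s (P n)))"
  have "\<forall>n \<epsilon>. \<exists>s. n \<ge> 1 \<and> \<epsilon> \<in> {0<..<1/2} \<longrightarrow> s \<in> prob_vecs n \<and>
    (\<forall>\<delta> t. 0 < \<delta> \<longrightarrow> \<delta> < 1 \<longrightarrow> 1 - \<delta> < mixing_dist (P n) t \<longrightarrow>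
      (1 - \<delta>) * (1 - (1 - \<alpha> n \<epsilon>) ^ Suc t) - 3 * sqrt \<delta> \<le> ?d n \<epsilon> s)"
    using ex_best_restart[OF P _ rev \<alpha>] by blast
  then obtain \<sigma> where "\<forall>n \<epsilon>. n \<ge> 1 \<and> \<epsilon> \<in> {0<..<1/2} \<longrightarrow> \<sigma> n \<epsilon> \<in> prob_vecs n \<and>
    (\<forall>\<delta> t. 0 < \<delta> \<longrightarrow> \<delta> < 1 \<longrightarrow> 1 - \<delta> < mixing_dist (P n) t \<longrightarrow>
      (1 - \<delta>) * (1 - (1 - \<alpha> n \<epsilon>) ^ Suc t) - 3 * sqrt \<delta> \<le> ?d n \<epsilon> (\<sigma> n \<epsilon>))"
    by metis
  then have \<sigma>: "\<And>n \<epsilon>. n \<ge> 1 \<Longrightarrow> \<epsilon> \<in> {0<..<1/2} \<Longrightarrow> \<sigma> n \<epsilon> \<in> prob_vecs n"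
    and tv: "\<And>n \<epsilon> \<delta> t. n \<ge> 1 \<Longrightarrow> \<epsilon> \<in> {0<..<1/2} \<Longrightarrow> 0 < \<delta> \<Longrightarrow> \<delta> < 1 \<Longrightarrow> 1 - \<delta> < mixing_dist (P n) t \<Longrightarrow>
      (1 - \<delta>) * (1 - (1 - \<alpha> n \<epsilon>) ^ Suc t) - 3 * sqrt \<delta> \<le> ?d n \<epsilon> (\<sigma> n \<epsilon>)" by blast+
  have "(\<lambda>n. ?d n \<epsilon> (\<sigma> n \<epsilon>)) \<longlonglongrightarrow> 1" if \<epsilon>: "\<epsilon> \<in> {0<..<1/2}" for \<epsilon>
  proof (rule tendstoI)
    fix e :: real assume "0 < e"
    define b where "b = min e 1"
    \<comment> \<open>The losses are \<delta> <= b/16, 3 sqrt \<delta> = 3b/16 and (1 - \<alpha>)^T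
      <= b/4, together at most b/2 < e. The last one needs \<alpha> T >= ln (4/b).\<close>
    define \<delta> where "\<delta> = (b / 16)\<^sup>2"
    have b: "0 < b" "b \<le> 1" "b \<le> e" using \<open>0 < e\<close> by (auto simp: b_def)
    have sq: "sqrt \<delta> = b / 16" using b by (simp add: \<delta>_def)
    have "\<delta> \<le> b / 16 * 1" unfolding \<delta>_def power2_eq_square using b by (intro mult_left_mono) auto
    then have \<delta>: "0 < \<delta>" "\<delta> \<le> b / 16" using b by (auto simp: \<delta>_def)
    then have \<delta>': "\<delta> \<in> {0<..<1/2}" using b by auto
    have M: "0 < ln (4 / b)" using b by simp
    have "\<forall>\<^sub>F n in sequentially. ln (4 / b) \<le> \<alpha> n \<epsilon> * real (t_mix (P n) (1 - \<delta>))"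
      by (rule coinciding_restart_fast[OF P lz pc co \<alpha> \<epsilon> \<delta>'])
    then show "\<forall>\<^sub>F n in sequentially. dist (?d n \<epsilon> (\<sigma> n \<epsilon>)) 1 < e"
      using eventually_ge_at_top[of 1]
    proof eventually_elim
      case (elim n)
      note n = elim(2)
      let ?a = "\<alpha> n \<epsilon>" and ?T = "t_mix (P n) (1 - \<delta>)"
      note a = \<alpha>[OF n \<epsilon>]
      have "0 < ?T" using elim(1) M by (cases "?T = 0") auto
      then have T: "Suc (?T - 1) = ?T" by simp
      \<comment> \<open>T is the least mixed time, so T - 1 is not mixed, and the exponent
        \<open>Suc (T - 1)\<close> is exactly T.\<close>
      have "1 - \<delta> < mixing_dist (P n) (?T - 1)"
        using not_less_Least[of "?T - 1" "\<lambda>t. mixing_dist (P n) t \<le> 1 - \<delta>"] \<open>0 < ?T\<close>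
        by (simp add: t_mix_def)
      then have lower: "(1 - \<delta>) * (1 - (1 - ?a) ^ ?T) - 3 * sqrt \<delta> \<le> ?d n \<epsilon> (\<sigma> n \<epsilon>)"
        using tv[OF n \<epsilon> \<delta>(1), of "?T - 1"] \<delta>' T by simp
      have "(1 - ?a) ^ ?T \<le> exp (- ?a) ^ ?T"
        using a exp_ge_add_one_self[of "- ?a"] by (intro power_mono) auto
      also have "\<dots> = exp (- (?a * real ?T))" by (simp add: mult.commute flip: exp_of_nat_mult)
      also have "\<dots> \<le> exp (- ln (4 / b))" using elim(1) by simp
      also have "\<dots> = b / 4" using b by (simp add: exp_minus)
      finally have p: "(1 - ?a) ^ ?T \<le> b / 4" .
      have "(1 - \<delta>) * (1 - b / 4) \<le> (1 - \<delta>) * (1 - (1 - ?a) ^ ?T)"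
        using p \<delta>' by (intro mult_left_mono) auto
      moreover have "1 - \<delta> - b / 4 \<le> (1 - \<delta>) * (1 - b / 4)"
        using \<delta>(1) b(1) by (simp add: algebra_simps)
      moreover have "?d n \<epsilon> (\<sigma> n \<epsilon>) \<le> 1"
        using P[OF n] \<sigma>[OF n \<epsilon>] a n
        by (intro tv_dist_le_1[of _ n] stationary_dist restart_stationary) (auto simp: ergodic_mats_def)
      ultimately have "1 - e < ?d n \<epsilon> (\<sigma> n \<epsilon>)" "?d n \<epsilon> (\<sigma> n \<epsilon>) \<le> 1"
        using lower sq \<delta>(2) b by linarith+
      then show ?case by (simp add: dist_real_def)
    qed
  qed
  with \<sigma> show "\<exists>\<sigma>. (\<forall>n\<ge>1. \<forall>\<epsilon>\<in>{0<..<1/2}. \<sigma> n \<epsilon> \<in> prob_vecs n) \<and>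
      (\<forall>\<epsilon>\<in>{0<..<1/2}. (\<lambda>n. ?d n \<epsilon> (\<sigma> n \<epsilon>)) \<longlonglongrightarrow> 1)"
    by (intro exI[of _ \<sigma>]) blast
qed

text \<open>
  The witness is \<open>\<alpha>\<^sub>\<epsilon> = 1 / (2 t(1 - \<epsilon>))\<close>: no restart occurs before \<open>t(1 - \<epsilon>)\<close> with probability
  at least \<open>1/2\<close>, so the restarted chain stays at distance at most \<open>1 - \<epsilon>/2\<close> from \<open>\<pi>\<close>.
\<close>

lemma no_cutoff_imp_not_restart_sensitive:
  fixes P :: "nat \<Rightarrow> real mat"
  assumes P: "\<And>n. n \<ge> 1 \<Longrightarrow> P n \<in> ergodic_mats n" and lz: "\<And>n. n \<ge> 1 \<Longrightarrow> lazy_chain (P n)"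
    and gap: "(SUP \<epsilon>\<in>{0<..<1/2}.
      liminf (\<lambda>n. ereal (real (t_mix (P n) \<epsilon>) / real (t_mix (P n) (1 - \<epsilon>))))) = \<infinity>"
  shows "\<not> restart_sensitive P"
proof
  assume rs: "restart_sensitive P"
  let ?q = "\<lambda>\<epsilon> n. real (t_mix (P n) \<epsilon>) / real (t_mix (P n) (1 - \<epsilon>))"
  \<comment> \<open>The maximum with 1 keeps \<alpha> inside (0,1) for the small n at which the
    mixing time is 0.\<close>
  define \<alpha> where "\<alpha> = (\<lambda>n \<epsilon>. 1 / (2 * max 1 (real (t_mix (P n) (1 - \<epsilon>)))))"
  have \<alpha>: "\<alpha> n \<epsilon> \<in> {0<..<1}" for n \<epsilon> by (simp add: \<alpha>_def)
  have "(SUP \<epsilon>\<in>{0<..<1/2}. liminf (\<lambda>n. ereal (\<alpha> n \<epsilon> * real (t_mix (P n) \<epsilon>)))) = \<infinity>"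
  proof (rule ereal_top)
    fix B
    have "ereal (2 * B) < (SUP \<epsilon>\<in>{0<..<1/2}. liminf (\<lambda>n. ereal (?q \<epsilon> n)))" unfolding gap by simp
    then obtain \<epsilon> where \<epsilon>: "\<epsilon> \<in> {0<..<1/2}" "ereal (2 * B) < liminf (\<lambda>n. ereal (?q \<epsilon> n))"
      unfolding less_SUP_iff by blast
    have "\<forall>\<^sub>F n in sequentially. 1 / real n < \<epsilon>"
      using order_tendstoD(2)[OF lim_1_over_n[where 'a = real], of \<epsilon>] \<epsilon> by simp
    with less_LiminfD[OF \<epsilon>(2)]
    have "\<forall>\<^sub>F n in sequentially. ereal B \<le> ereal (\<alpha> n \<epsilon> * real (t_mix (P n) \<epsilon>))"
      using eventually_ge_at_top[of 1]
    proof eventually_elim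
      case (elim n)
      have "0 < t_mix (P n) (1 - \<epsilon>)"
        by (rule t_mix_pos[OF P[OF elim(3)] elim(3) lz[OF elim(3)] _ elim(2)]) (use \<epsilon>(1) in auto)
      then have "max 1 (real (t_mix (P n) (1 - \<epsilon>))) = real (t_mix (P n) (1 - \<epsilon>))" by simp
      then show ?case using elim(1) by (simp add: \<alpha>_def)
    qed
    then have "ereal B \<le> liminf (\<lambda>n. ereal (\<alpha> n \<epsilon> * real (t_mix (P n) \<epsilon>)))" by (rule Liminf_bounded)
    also have "\<dots> \<le> (SUP \<epsilon>\<in>{0<..<1/2}. liminf (\<lambda>n. ereal (\<alpha> n \<epsilon> * real (t_mix (P n) \<epsilon>))))"
      by (rule SUP_upper[OF \<epsilon>(1)])
    finally show "ereal B \<le> (SUP \<epsilon>\<in>{0<..<1/2}. liminf (\<lambda>n. ereal (\<alpha> n \<epsilon> * real (t_mix (P n) \<epsilon>))))" .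
  qed
  moreover have "\<alpha> n \<epsilon> / \<alpha> n \<delta> \<in> {real (t_mix (P n) (1 - \<delta>)) / real (t_mix (P n) (1 - \<epsilon>))..1}"
    if "\<epsilon> \<in> {0<..<1/2}" "\<delta> \<in> {0<..<1/2}" "n \<ge> 1" "\<delta> \<le> \<epsilon>" for n \<epsilon> \<delta>
  proof -
    define x y where "x = real (t_mix (P n) (1 - \<delta>))" and "y = real (t_mix (P n) (1 - \<epsilon>))"
    have "x \<le> y" "0 \<le> x"
      using t_mix_antimono[OF P[OF that(3)] that(3) lz[OF that(3)], of "1 - \<epsilon>" "1 - \<delta>"] that
      by (auto simp: x_def y_def)
    \<comment> \<open>If y = 0 the lower bound is x / 0 = 0; if y >= 1 it is x / y, which is at most
      max 1 x / max 1 y.\<close>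
    moreover have "y = 0 \<or> 1 \<le> y" by (auto simp: y_def)
    moreover have "\<alpha> n \<epsilon> / \<alpha> n \<delta> = max 1 x / max 1 y" by (simp add: \<alpha>_def x_def y_def)
    ultimately show ?thesis
      unfolding x_def[symmetric] y_def[symmetric] by (auto intro: divide_right_mono simp: max_def)
  qed
  ultimately have "coincides_with_mixing_times P \<alpha>"
    unfolding coincides_with_mixing_times_def by blast
  with rs \<alpha> obtain \<sigma> where \<sigma>: "\<forall>n\<ge>1. \<forall>\<epsilon>\<in>{0<..<1/2}. \<sigma> n \<epsilon> \<in> prob_vecs n"
    and lim: "\<forall>\<epsilon>\<in>{0<..<1/2}. (\<lambda>n. tv_dist (stationary_dist (P n))
      (stationary_dist (restart_mat (\<alpha> n \<epsilon>) (\<sigma> n \<epsilon>) (P n)))) \<longlonglongrightarrow> (1 :: real)"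
    unfolding restart_sensitive_def by blast
  \<comment> \<open>One parameter is enough to refute the limit. At \<epsilon> = 1/4 the distance is
    at most 1 - (1/2) (1/4) = 7/8, where 1/2 is Bernoulli's bound for (1 - \<alpha>)^T with \<alpha>
    T <= 1/2.\<close>
  let ?d = "\<lambda>n. tv_dist (stationary_dist (P n))
      (stationary_dist (restart_mat (\<alpha> n (1/4)) (\<sigma> n (1/4)) (P n)))"
  have "?d \<longlonglongrightarrow> 1" by (rule bspec[OF lim]) simp
  moreover have "?d n \<le> 7 / 8" if n: "n \<ge> 1" for n
  proof -
    let ?a = "\<alpha> n (1/4)" and ?T = "t_mix (P n) (1 - 1/4)"
    have s: "\<sigma> n (1/4) \<in> prob_vecs n" using \<sigma> n by simp
    have "real ?T * ?a \<le> 1 / 2" by (simp add: \<alpha>_def field_simps)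
    moreover have "1 + real ?T * (- ?a) \<le> (1 + (- ?a)) ^ ?T"
      using \<alpha>[of n "1/4"] by (intro Bernoulli_inequality) simp
    ultimately have "1 / 2 \<le> (1 - ?a) ^ ?T" by simp
    moreover have "?d n \<le> 1 - (1 - ?a) ^ ?T * (1 - (1 - 1/4))"
      by (rule restart_tv_le[OF P[OF n] n s \<alpha> mixing_dist_t_mix[OF P[OF n] n lz[OF n]]]) simp_all
    ultimately show ?thesis by simp
  qed
  ultimately have "(1 :: real) \<le> 7 / 8"
    by (intro LIMSEQ_le_const2[of ?d]) auto
  then show False by simp
qed

theorem theorem2:
  fixes P :: "nat \<Rightarrow> real mat"
  assumes "\<And>n. n \<ge> 1 \<Longrightarrow> P n \<in> ergodic_mats n"
    and "\<And>n. n \<ge> 1 \<Longrightarrow> lazy_chain (P n)"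
    and "\<And>n. n \<ge> 1 \<Longrightarrow> reversible_chain (P n)"
  shows "(pre_cutoff P \<longrightarrow> restart_sensitive P) \<and>
    ((SUP \<epsilon>\<in>{0<..<1/2}. liminf (\<lambda>n. ereal (real (t_mix (P n) \<epsilon>) / real (t_mix (P n) (1 - \<epsilon>))))) = \<infinity>
       \<longrightarrow> \<not> restart_sensitive P)"
  using pre_cutoff_imp_restart_sensitive[OF assms] no_cutoff_imp_not_restart_sensitive[OF assms(1,2)]
  by blast

end
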